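(* Let $G$ be a connected graph with $\chi(G)=2$. Then $G$ is enumeratively chromatic-choosable if and only if the core of $G$ is isomorphic to one of: $K_1$; the cycle $C_{2k+2}$ for some $k \in \mathbb{N}=\{1,2,3,\dots\}$; or $K_{2,3}$.
   Context: All graphs are finite, simple and nonempty. A list assignment $L$ for $G$ assigns to each vertex $v$ a set $L(v)$ of colors; it is an $m$-assignment if $|L(v)|=m$ for all $v$. A proper $L$-coloring is a proper coloring $f$ with $f(v)\in L(v)$ for all $v$; $P(G,L)$ is the number of proper $L$-colorings. $P(G,m)$ is the chromatic polynomial (number of proper colorings with colors from $\{1,\dots,m\}$), and the list color function $P_\ell(G,m)$ is the minimum of $P(G,L)$ over all $m$-assignments $L$ of $G$. A graph $G$ is enumeratively chromatic-choosable if $P_\ell(G,m)=P(G,m)$ for every integer $m\ge \chi(G)$. The core of a connected graph $G$ is the graph obtained from $G$ by successively deleting vertices of degree 1 (the core of a tree is $K_1$). *)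

theory Defs
  imports "HOL-Library.FuncSet"
begin

definition simple_graph :: "'a set \<Rightarrow> 'a set set \<Rightarrow> bool" where
  "simple_graph V E \<longleftrightarrow> finite V \<and> V \<noteq> {} \<and> (\<forall>e\<in>E. e \<subseteq> V \<and> card e = 2)"

definition connected_graph :: "'a set \<Rightarrow> 'a set set \<Rightarrow> bool" where
  "connected_graph V E \<longleftrightarrow> (\<forall>u\<in>V. \<forall>v\<in>V. (\<lambda>x y. {x, y} \<in> E)\<^sup>*\<^sup>* u v)"

definition proper_col :: "'a set set \<Rightarrow> ('a \<Rightarrow> 'c) \<Rightarrow> bool" where
  "proper_col E f \<longleftrightarrow> (\<forall>e\<in>E. \<forall>u\<in>e. \<forall>v\<in>e. u \<noteq> v \<longrightarrow> f u \<noteq> f v)"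

definition num_L_colorings :: "'a set \<Rightarrow> 'a set set \<Rightarrow> ('a \<Rightarrow> nat set) \<Rightarrow> nat" where
  "num_L_colorings V E L = card {f \<in> Pi\<^sub>E V L. proper_col E f}"

definition chrom_poly :: "'a set \<Rightarrow> 'a set set \<Rightarrow> nat \<Rightarrow> nat" where
  "chrom_poly V E m = num_L_colorings V E (\<lambda>_. {1..m})"

definition chromatic_number :: "'a set \<Rightarrow> 'a set set \<Rightarrow> nat" where
  "chromatic_number V E = (LEAST k. chrom_poly V E k > 0)"

definition m_assignment :: "'a set \<Rightarrow> nat \<Rightarrow> ('a \<Rightarrow> nat set) \<Rightarrow> bool" where
  "m_assignment V m L \<longleftrightarrow> (\<forall>v\<in>V. finite (L v) \<and> card (L v) = m)"

definition list_color_fun :: "'a set \<Rightarrow> 'a set set \<Rightarrow> nat \<Rightarrow> nat" where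
  "list_color_fun V E m = (LEAST n. \<exists>L. m_assignment V m L \<and> n = num_L_colorings V E L)"

definition enum_chromatic_choosable :: "'a set \<Rightarrow> 'a set set \<Rightarrow> bool" where
  "enum_chromatic_choosable V E \<longleftrightarrow>
     (\<forall>m. m \<ge> chromatic_number V E \<longrightarrow> list_color_fun V E m = chrom_poly V E m)"

definition degree :: "'a set \<Rightarrow> 'a set set \<Rightarrow> 'a \<Rightarrow> nat" where
  "degree V E v = card {u \<in> V. {u, v} \<in> E}"

definition delete_leaf :: "'a set \<times> 'a set set \<Rightarrow> 'a set \<times> 'a set set \<Rightarrow> bool" where
  "delete_leaf G H \<longleftrightarrow> (\<exists>v\<in>fst G. degree (fst G) (snd G) v = 1 \<and>
      H = (fst G - {v}, {e \<in> snd G. v \<notin> e}))"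

definition is_core :: "'a set \<times> 'a set set \<Rightarrow> 'a set \<times> 'a set set \<Rightarrow> bool" where
  "is_core G H \<longleftrightarrow> delete_leaf\<^sup>*\<^sup>* G H \<and> (\<forall>v\<in>fst H. degree (fst H) (snd H) v \<noteq> 1)"

definition graph_iso :: "'a set \<times> 'a set set \<Rightarrow> 'b set \<times> 'b set set \<Rightarrow> bool" where
  "graph_iso G H \<longleftrightarrow> (\<exists>f. bij_betw f (fst G) (fst H) \<and>
      (\<forall>u\<in>fst G. \<forall>v\<in>fst G. {u, v} \<in> snd G \<longleftrightarrow> {f u, f v} \<in> snd H))"

definition K1 :: "nat set \<times> nat set set" where
  "K1 = ({0}, {})"

definition cycle_graph :: "nat \<Rightarrow> nat set \<times> nat set set" where
  "cycle_graph n = ({0..<n}, {{i, (i + 1) mod n} | i. i < n})"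

definition K23 :: "nat set \<times> nat set set" where
  "K23 = ({0..<5}, {{i, j} | i j. i \<in> {0, 1} \<and> j \<in> {2, 3, 4}})"

end

theory Submission
  imports Defs
begin

text \<open>
  Deleting a leaf divides the chromatic polynomial by \<open>m - 1\<close> and the number of list colourings by
  at least \<open>m - 1\<close>, so for the positive direction only \<open>K\<^sub>1\<close>, the even cycles and \<open>K\<^sub>2\<^sub>,\<^sub>3\<close> matter.
  On a cycle whose lists are not all equal, cut the cycle between two vertices with different lists
  and compare the colourings of the resulting path with walks in \<open>K\<^sub>m\<close>. On \<open>K\<^sub>2\<^sub>,\<^sub>3\<close>, sum over the
  colours of the two vertices of degree three.

  For the converse only \<open>m = 2\<close> is needed, where a connected bipartite graph has two colourings.
  Lists of size two on a vertex set that allow at most one colouring there extend to the whole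
  connected graph: a new vertex copies the list of a neighbour. Such lists exist on two cycles
  that share at most one vertex and are joined by a path, on every theta graph with paths of equal
  parity other than \<open>K\<^sub>2\<^sub>,\<^sub>3\<close>, and on \<open>K\<^sub>2\<^sub>,\<^sub>4\<close>. A maximal path outside a cycle, and then outside a
  \<open>K\<^sub>2\<^sub>,\<^sub>3\<close>, shows that any other core contains one of these graphs.
\<close>

text \<open>Rigidity asks for at most one colouring, not for none, because of the theta graphs with
  two paths of length 2 and one longer path of even length. They are 2-choosable, so no lists of
  size two on them exclude every colouring, and only a unique colouring separates them from
  \<open>K23\<close>.

  On cycles the parity of the length decides. For walks with an odd number of steps, the complete
  graph on \<open>m\<close> colours has one walk fewer from a colour back to itself than to any
  other colour. With constant lists the edge that closes an even cycle removes exactly these rarer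
  ends. With other lists the rare end colour may differ from the removed one, which costs one
  colouring for that start colour. The cut is placed where the lists differ, so that some start
  colour loses no end at all; for \<open>m >= 3\<close> this gain covers all losses. For
  \<open>m = 2\<close> it is too small, and a direct argument takes over.\<close>

definition count_minimal :: "'a set \<times> 'a set set \<Rightarrow> nat \<Rightarrow> bool" where
  "count_minimal G m \<longleftrightarrow> (\<forall>L. m_assignment (fst G) m L \<longrightarrow>
     chrom_poly (fst G) (snd G) m \<le> num_L_colorings (fst G) (snd G) L)"

lemma edge_distinct:
  assumes "simple_graph V E" "{u, v} \<in> E"
  shows "u \<noteq> v" "u \<in> V" "v \<in> V"
  using assms unfolding simple_graph_def by force+

lemma edge_pair:
  assumes "simple_graph V E" "e \<in> E"
  obtains u v where "e = {u, v}" "u \<in> V" "v \<in> V" "u \<noteq> v"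
  using assms unfolding simple_graph_def by (metis card_2_iff insert_subset)

lemma proper_col_iff:
  assumes "simple_graph V E"
  shows "proper_col E f \<longleftrightarrow> (\<forall>u v. {u, v} \<in> E \<longrightarrow> f u \<noteq> f v)"
proof
  assume "proper_col E f"
  then show "\<forall>u v. {u, v} \<in> E \<longrightarrow> f u \<noteq> f v"
    using edge_distinct[OF assms] unfolding proper_col_def by blast
next
  assume *: "\<forall>u v. {u, v} \<in> E \<longrightarrow> f u \<noteq> f v"
  show "proper_col E f"
    unfolding proper_col_def
  proof (intro ballI impI)
    fix e u v assume "e \<in> E" "u \<in> e" "v \<in> e" "u \<noteq> v"
    moreover obtain a b where "e = {a, b}" using edge_pair[OF assms \<open>e \<in> E\<close>] by blast
    ultimately have "e = {u, v}" by auto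
    then show "f u \<noteq> f v" using * \<open>e \<in> E\<close> by blast
  qed
qed

lemma finite_L_colorings:
  assumes "finite V" "m_assignment V m L"
  shows "finite {f \<in> Pi\<^sub>E V L. proper_col E f}"
proof -
  have "finite (Pi\<^sub>E V L)"
    using assms unfolding m_assignment_def by (intro finite_PiE) auto
  then show ?thesis by simp
qed

lemma m_assignment_const: "m_assignment V m (\<lambda>_. {1..m})"
  by (simp add: m_assignment_def)

text \<open>The constant lists make the chromatic polynomial one of the values that are minimised,
  so only the lower bound for all other lists remains to be shown.\<close>

lemma list_color_fun_eq_iff:
  "list_color_fun V E m = chrom_poly V E m \<longleftrightarrow> count_minimal (V, E) m"
proof -
  let ?P = "\<lambda>n. \<exists>L. m_assignment V m L \<and> n = num_L_colorings V E L"
  have P: "?P (chrom_poly V E m)"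
    using m_assignment_const chrom_poly_def by blast
  show ?thesis
  proof
    assume eq: "list_color_fun V E m = chrom_poly V E m"
    show "count_minimal (V, E) m"
      unfolding count_minimal_def
    proof (intro allI impI)
      fix L assume "m_assignment (fst (V, E)) m L"
      then have "?P (num_L_colorings V E L)" by auto
      then have "list_color_fun V E m \<le> num_L_colorings V E L"
        unfolding list_color_fun_def by (rule Least_le)
      then show "chrom_poly (fst (V, E)) (snd (V, E)) m \<le> num_L_colorings (fst (V, E)) (snd (V, E)) L"
        using eq by simp
    qed
  next
    assume "count_minimal (V, E) m"
    then show "list_color_fun V E m = chrom_poly V E m"
      unfolding list_color_fun_def using P
      by (intro Least_equality) (auto simp: count_minimal_def)
  qed
qed

section \<open>Invariance under isomorphism and leaf deletion\<close>

text \<open>Besides isomorphic graphs this serves for the rotations of a single cycle, which bring a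
  place where the lists change to the cut.\<close>

lemma num_L_colorings_iso:
  assumes G: "simple_graph V E" and H: "simple_graph V' E'"
    and \<phi>: "bij_betw \<phi> V V'"
    and adj: "\<And>u v. u \<in> V \<Longrightarrow> v \<in> V \<Longrightarrow> {u, v} \<in> E \<longleftrightarrow> {\<phi> u, \<phi> v} \<in> E'"
  shows "num_L_colorings V E (\<lambda>v. L (\<phi> v)) = num_L_colorings V' E' L"
proof -
  let ?\<psi> = "inv_into V \<phi>"
  have \<psi>: "\<And>v. v \<in> V' \<Longrightarrow> ?\<psi> v \<in> V \<and> \<phi> (?\<psi> v) = v"
    by (meson \<phi> bij_betw_def f_inv_into_f inv_into_into bij_betw_imp_surj_on bij_betw_inv_into_right bij_betwE bij_betw_inv_into)
  have \<psi>': "\<And>v. v \<in> V \<Longrightarrow> \<phi> v \<in> V' \<and> ?\<psi> (\<phi> v) = v"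
    by (meson \<phi> bij_betw_inv_into_left bij_betwE)
  have "bij_betw (\<lambda>f. restrict (\<lambda>v. f (\<phi> v)) V) {f \<in> Pi\<^sub>E V' L. proper_col E' f}
          {f \<in> Pi\<^sub>E V (\<lambda>v. L (\<phi> v)). proper_col E f}"
  proof (rule bij_betw_byWitness[where f' = "\<lambda>f. restrict (\<lambda>v. f (?\<psi> v)) V'"])
    show "\<forall>f\<in>{f \<in> Pi\<^sub>E V' L. proper_col E' f}.
        restrict (\<lambda>v. restrict (\<lambda>v. f (\<phi> v)) V (?\<psi> v)) V' = f"
      using \<psi> by (auto simp: fun_eq_iff PiE_def extensional_def)
    show "\<forall>f\<in>{f \<in> Pi\<^sub>E V (\<lambda>v. L (\<phi> v)). proper_col E f}.
        restrict (\<lambda>v. restrict (\<lambda>v. f (?\<psi> v)) V' (\<phi> v)) V = f"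
      using \<psi>' by (auto simp: fun_eq_iff PiE_def extensional_def)
    show "(\<lambda>f. restrict (\<lambda>v. f (\<phi> v)) V) ` {f \<in> Pi\<^sub>E V' L. proper_col E' f}
        \<subseteq> {f \<in> Pi\<^sub>E V (\<lambda>v. L (\<phi> v)). proper_col E f}"
    proof (rule image_subsetI)
      fix f assume "f \<in> {f \<in> Pi\<^sub>E V' L. proper_col E' f}"
      then have f: "f \<in> Pi\<^sub>E V' L" "proper_col E' f" by auto
      have "proper_col E (restrict (\<lambda>v. f (\<phi> v)) V)"
        unfolding proper_col_iff[OF G]
      proof (intro allI impI)
        fix u v assume uv: "{u, v} \<in> E"
        then have "u \<in> V" "v \<in> V" using edge_distinct[OF G] by auto
        then show "restrict (\<lambda>v. f (\<phi> v)) V u \<noteq> restrict (\<lambda>v. f (\<phi> v)) V v"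
          using f(2) uv adj[of u v] unfolding proper_col_iff[OF H] by simp
      qed
      then show "restrict (\<lambda>v. f (\<phi> v)) V \<in> {f \<in> Pi\<^sub>E V (\<lambda>v. L (\<phi> v)). proper_col E f}"
        using f(1) \<psi>' by auto
    qed
    show "(\<lambda>f. restrict (\<lambda>v. f (?\<psi> v)) V') ` {f \<in> Pi\<^sub>E V (\<lambda>v. L (\<phi> v)). proper_col E f}
        \<subseteq> {f \<in> Pi\<^sub>E V' L. proper_col E' f}"
    proof (rule image_subsetI)
      fix f assume "f \<in> {f \<in> Pi\<^sub>E V (\<lambda>v. L (\<phi> v)). proper_col E f}"
      then have f: "f \<in> Pi\<^sub>E V (\<lambda>v. L (\<phi> v))" "proper_col E f" by auto
      have "proper_col E' (restrict (\<lambda>v. f (?\<psi> v)) V')"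
        unfolding proper_col_iff[OF H]
      proof (intro allI impI)
        fix u v assume "{u, v} \<in> E'"
        moreover from this have "u \<in> V'" "v \<in> V'" using edge_distinct[OF H] by auto
        ultimately have "{?\<psi> u, ?\<psi> v} \<in> E" using adj \<psi> by simp
        then show "restrict (\<lambda>v. f (?\<psi> v)) V' u \<noteq> restrict (\<lambda>v. f (?\<psi> v)) V' v"
          using f(2) \<open>u \<in> V'\<close> \<open>v \<in> V'\<close> unfolding proper_col_iff[OF G] by auto
      qed
      moreover have "restrict (\<lambda>v. f (?\<psi> v)) V' \<in> Pi\<^sub>E V' L"
        using f(1) \<psi> by (fastforce simp: PiE_def Pi_def)
      ultimately show "restrict (\<lambda>v. f (?\<psi> v)) V' \<in> {f \<in> Pi\<^sub>E V' L. proper_col E' f}"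
        by simp
    qed
  qed
  from bij_betw_same_card[OF this] show ?thesis
    by (simp add: num_L_colorings_def)
qed

lemma num_L_colorings_cong:
  assumes "\<And>v. v \<in> V \<Longrightarrow> L v = L' v"
  shows "num_L_colorings V E L = num_L_colorings V E L'"
  using PiE_cong[of V L L'] assms by (simp add: num_L_colorings_def)

lemma count_minimal_iso:
  assumes G: "simple_graph V E" and H: "simple_graph V' E'"
    and iso: "graph_iso (V, E) (V', E')" and min: "count_minimal (V', E') m"
  shows "count_minimal (V, E) m"
  unfolding count_minimal_def
proof (intro allI impI)
  fix L assume "m_assignment (fst (V, E)) m L"
  then have L: "m_assignment V m L" by simp
  obtain \<phi> where \<phi>: "bij_betw \<phi> V V'"
    and adj: "\<And>u v. u \<in> V \<Longrightarrow> v \<in> V \<Longrightarrow> {u, v} \<in> E \<longleftrightarrow> {\<phi> u, \<phi> v} \<in> E'"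
    using iso unfolding graph_iso_def by auto
  let ?L = "\<lambda>v. L (inv_into V \<phi> v)"
  have "m_assignment V' m ?L"
    using L \<phi> unfolding m_assignment_def
    by (metis bij_betw_imp_surj_on inv_into_into)
  then have "chrom_poly V' E' m \<le> num_L_colorings V' E' ?L"
    using min by (simp add: count_minimal_def)
  moreover have "chrom_poly V E m = chrom_poly V' E' m"
    using num_L_colorings_iso[OF G H \<phi> adj, of "\<lambda>_. {1..m}"] by (simp add: chrom_poly_def)
  moreover have "num_L_colorings V E L = num_L_colorings V E (\<lambda>v. ?L (\<phi> v))"
    by (rule num_L_colorings_cong) (simp add: bij_betw_inv_into_left[OF \<phi>])
  ultimately show "chrom_poly (fst (V, E)) (snd (V, E)) m \<le> num_L_colorings (fst (V, E)) (snd (V, E)) L"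
    using num_L_colorings_iso[OF G H \<phi> adj, of ?L] by simp
qed

lemma delete_leafE:
  assumes G: "simple_graph V E" and del: "delete_leaf (V, E) H"
  obtains u v where "u \<in> V" "v \<in> V" "u \<noteq> v" "{u, v} \<in> E" "\<And>w. {w, v} \<in> E \<Longrightarrow> w = u"
    "H = (V - {v}, {e \<in> E. v \<notin> e})"
proof -
  obtain v where v: "v \<in> V" "degree V E v = 1" "H = (V - {v}, {e \<in> E. v \<notin> e})"
    using del unfolding delete_leaf_def by auto
  then obtain u where "{u \<in> V. {u, v} \<in> E} = {u}"
    unfolding degree_def by (metis card_1_singletonE)
  then have u: "u \<in> V" "{u, v} \<in> E" "\<And>w. {w, v} \<in> E \<Longrightarrow> w = u"
    using edge_distinct[OF G] by auto
  have "u \<noteq> v" using edge_distinct[OF G u(2)] by simp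
  then show thesis using that u v by blast
qed

lemma simple_graph_delete_leaf:
  assumes G: "simple_graph V E" and del: "delete_leaf (V, E) H"
  shows "simple_graph (fst H) (snd H)"
proof -
  obtain u v where "u \<in> V" "v \<in> V" "u \<noteq> v" "H = (V - {v}, {e \<in> E. v \<notin> e})"
    by (rule delete_leafE[OF G del])
  then show ?thesis using G unfolding simple_graph_def by auto
qed

text \<open>Restriction to \<open>V - {v}\<close> has the sets \<open>L v - {f u}\<close> as fibres.
  They have \<open>m - 1\<close> or \<open>m\<close> elements according to whether
  \<open>f u\<close> lies in \<open>L v\<close>, so in general there is a sum and only for constant
  lists a product.\<close>

lemma num_L_colorings_leaf:
  assumes G: "simple_graph V E" and uv: "u \<in> V" "v \<in> V" "u \<noteq> v" "{u, v} \<in> E"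
    and leaf: "\<And>w. {w, v} \<in> E \<Longrightarrow> w = u"
    and L: "m_assignment V m L"
  shows "num_L_colorings V E L = (\<Sum>f\<in>{f \<in> Pi\<^sub>E (V - {v}) L. proper_col {e \<in> E. v \<notin> e} f}. card (L v - {f u}))"
proof -
  let ?E = "{e \<in> E. v \<notin> e}" and ?V = "V - {v}"
  let ?C = "{f \<in> Pi\<^sub>E ?V L. proper_col ?E f}"
  have G': "simple_graph ?V ?E" using G uv unfolding simple_graph_def by auto
  have proper: "proper_col E (f(v := c)) \<longleftrightarrow> proper_col ?E f \<and> c \<noteq> f u" for f :: "'a \<Rightarrow> nat" and c
    unfolding proper_col_iff[OF G] proper_col_iff[OF G']
  proof (intro iffI conjI allI impI)
    assume *: "\<forall>a b. {a, b} \<in> E \<longrightarrow> (f(v := c)) a \<noteq> (f(v := c)) b"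
    show "c \<noteq> f u" using *[rule_format, OF uv(4)] uv(3) by simp
    show "f a \<noteq> f b" if "{a, b} \<in> ?E" for a b using *[rule_format, of a b] that by auto
  next
    fix a b
    assume *: "(\<forall>u v. {u, v} \<in> ?E \<longrightarrow> f u \<noteq> f v) \<and> c \<noteq> f u" and ab: "{a, b} \<in> E"
    have "a \<noteq> b" using edge_distinct[OF G ab] by simp
    then show "(f(v := c)) a \<noteq> (f(v := c)) b"
      using * ab leaf[of a] leaf[of b] by (auto simp: insert_commute)
  qed
  have "bij_betw (\<lambda>(f, c). f(v := c)) (SIGMA f:?C. L v - {f u}) {f \<in> Pi\<^sub>E V L. proper_col E f}"
  proof (rule bij_betw_byWitness[where f' = "\<lambda>f. (restrict f ?V, f v)"])
    show "\<forall>p\<in>SIGMA f:?C. L v - {f u}.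
        (restrict (case p of (f, c) \<Rightarrow> f(v := c)) ?V, (case p of (f, c) \<Rightarrow> f(v := c)) v) = p"
      by (auto simp: PiE_def extensional_def fun_eq_iff)
    show "\<forall>f\<in>{f \<in> Pi\<^sub>E V L. proper_col E f}. (case (restrict f ?V, f v) of (f, c) \<Rightarrow> f(v := c)) = f"
      by (auto simp: PiE_def extensional_def fun_eq_iff)
    show "(\<lambda>(f, c). f(v := c)) ` (SIGMA f:?C. L v - {f u}) \<subseteq> {f \<in> Pi\<^sub>E V L. proper_col E f}"
      using uv(2) by (auto simp: proper PiE_def extensional_def)
    show "(\<lambda>f. (restrict f ?V, f v)) ` {f \<in> Pi\<^sub>E V L. proper_col E f} \<subseteq> (SIGMA f:?C. L v - {f u})"
    proof (rule image_subsetI)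
      fix f assume "f \<in> {f \<in> Pi\<^sub>E V L. proper_col E f}"
      then have f: "f \<in> Pi\<^sub>E V L" "proper_col E f" by auto
      have "(restrict f ?V)(v := f v) = f" using f(1) by (auto simp: PiE_def extensional_def fun_eq_iff)
      then have "proper_col ?E (restrict f ?V)" "f v \<noteq> restrict f ?V u"
        using proper[of "restrict f ?V" "f v"] f(2) by auto
      then show "(restrict f ?V, f v) \<in> (SIGMA f:?C. L v - {f u})"
        using f(1) uv by auto
    qed
  qed
  from bij_betw_same_card[OF this]
  have "num_L_colorings V E L = card (SIGMA f:?C. L v - {f u})"
    by (simp add: num_L_colorings_def)
  also have "\<dots> = (\<Sum>f\<in>?C. card (L v - {f u}))"
    using finite_L_colorings[of ?V m L ?E] G L uv(2)
    by (intro card_SigmaI) (auto simp: simple_graph_def m_assignment_def)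
  finally show ?thesis .
qed

lemma count_minimal_delete_leaf:
  assumes G: "simple_graph V E" and del: "delete_leaf (V, E) H" and min: "count_minimal H m"
  shows "count_minimal (V, E) m"
  unfolding count_minimal_def
proof (intro allI impI)
  fix L assume "m_assignment (fst (V, E)) m L"
  then have L: "m_assignment V m L" by simp
  obtain u v where uv: "u \<in> V" "v \<in> V" "u \<noteq> v" "{u, v} \<in> E" and leaf: "\<And>w. {w, v} \<in> E \<Longrightarrow> w = u"
    and H: "H = (V - {v}, {e \<in> E. v \<notin> e})"
    by (rule delete_leafE[OF G del]) (rule that; assumption)
  let ?E = "{e \<in> E. v \<notin> e}" and ?V = "V - {v}"
  have L': "m_assignment ?V m L" using L by (simp add: m_assignment_def)
  have "chrom_poly V E m =
      (\<Sum>f\<in>{f \<in> Pi\<^sub>E ?V (\<lambda>_. {1..m}). proper_col ?E f}. card ({1..m} - {f u}))"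
    unfolding chrom_poly_def by (rule num_L_colorings_leaf[OF G uv leaf m_assignment_const])
  also have "\<dots> = (\<Sum>f\<in>{f \<in> Pi\<^sub>E ?V (\<lambda>_. {1..m}). proper_col ?E f}. m - 1)"
    using uv by (intro sum.cong) (auto simp: PiE_def Pi_def)
  also have "\<dots> = chrom_poly ?V ?E m * (m - 1)"
    by (simp add: chrom_poly_def num_L_colorings_def)
  also have "\<dots> \<le> num_L_colorings ?V ?E L * (m - 1)"
    using min L' H by (simp add: count_minimal_def)
  also have "\<dots> = (\<Sum>f\<in>{f \<in> Pi\<^sub>E ?V L. proper_col ?E f}. m - 1)"
    by (simp add: num_L_colorings_def)
  also have "\<dots> \<le> (\<Sum>f\<in>{f \<in> Pi\<^sub>E ?V L. proper_col ?E f}. card (L v - {f u}))"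
    using L uv by (intro sum_mono) (auto simp: m_assignment_def card_Diff_singleton_if)
  also have "\<dots> = num_L_colorings V E L"
    by (rule num_L_colorings_leaf[OF G uv leaf L, symmetric])
  finally show "chrom_poly (fst (V, E)) (snd (V, E)) m \<le> num_L_colorings (fst (V, E)) (snd (V, E)) L"
    by simp
qed

lemma simple_graph_delete_leaves:
  assumes "delete_leaf\<^sup>*\<^sup>* G H" "simple_graph (fst G) (snd G)"
  shows "simple_graph (fst H) (snd H)"
  using assms(1)
proof induction
  case (step y z)
  then show ?case by (metis simple_graph_delete_leaf prod.collapse)
qed (use assms in simp)

lemma count_minimal_delete_leaves:
  assumes "delete_leaf\<^sup>*\<^sup>* G H" "simple_graph (fst G) (snd G)" "count_minimal H m"
  shows "count_minimal G m"
  using assms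
proof (induction rule: converse_rtranclp_induct)
  case (step y z)
  then show ?case
    by (metis count_minimal_delete_leaf simple_graph_delete_leaf prod.collapse)
qed

section \<open>Even cycles\<close>

text \<open>Transfer recursion along a path with start colour \<open>a\<close> and end colour
  \<open>b\<close>. The list of the end vertex does not enter, so end colours inside and outside
  \<open>L i\<close> can be compared.\<close>

primrec path_count :: "(nat \<Rightarrow> nat set) \<Rightarrow> nat \<Rightarrow> nat \<Rightarrow> nat \<Rightarrow> nat" where
  "path_count L a 0 b = (if b = a then 1 else 0)"
| "path_count L a (Suc i) b = (\<Sum>c\<in>L i - {b}. path_count L a i c)"

definition path_colorings :: "(nat \<Rightarrow> nat set) \<Rightarrow> nat \<Rightarrow> nat \<Rightarrow> nat \<Rightarrow> (nat \<Rightarrow> nat) set" where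
  "path_colorings L a i b =
     {f \<in> Pi\<^sub>E {..i} L. (\<forall>j<i. f j \<noteq> f (Suc j)) \<and> f 0 = a \<and> f i = b}"

lemma card_path_colorings:
  assumes "\<And>j. j \<le> i \<Longrightarrow> finite (L j)" "a \<in> L 0" "b \<in> L i"
  shows "finite (path_colorings L a i b) \<and> card (path_colorings L a i b) = path_count L a i b"
  using assms
proof (induction i arbitrary: b)
  case 0
  have "path_colorings L a 0 b = (if b = a then {\<lambda>j\<in>{..0}. a} else {})"
    using 0 by (auto simp: path_colorings_def PiE_def extensional_def fun_eq_iff)
  then show ?case by simp
next
  case (Suc i)
  have IH: "finite (path_colorings L a i c) \<and> card (path_colorings L a i c) = path_count L a i c"
    if "c \<in> L i" for c using Suc that by simp
  have "bij_betw (\<lambda>(c, f). f(Suc i := b)) (SIGMA c:L i - {b}. path_colorings L a i c)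
      (path_colorings L a (Suc i) b)"
  proof (rule bij_betw_byWitness[where f' = "\<lambda>f. (f i, restrict f {..i})"])
    show "\<forall>p\<in>SIGMA c:L i - {b}. path_colorings L a i c.
        ((case p of (c, f) \<Rightarrow> f(Suc i := b)) i, restrict (case p of (c, f) \<Rightarrow> f(Suc i := b)) {..i}) = p"
      by (auto simp: path_colorings_def PiE_def extensional_def fun_eq_iff)
    show "\<forall>f\<in>path_colorings L a (Suc i) b. (case (f i, restrict f {..i}) of (c, f) \<Rightarrow> f(Suc i := b)) = f"
      by (auto simp: path_colorings_def PiE_def extensional_def fun_eq_iff)
    show "(\<lambda>(c, f). f(Suc i := b)) ` (SIGMA c:L i - {b}. path_colorings L a i c)
        \<subseteq> path_colorings L a (Suc i) b"
      using Suc.prems by (auto simp: path_colorings_def PiE_def extensional_def less_Suc_eq Pi_def le_Suc_eq)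
    show "(\<lambda>f. (f i, restrict f {..i})) ` path_colorings L a (Suc i) b
        \<subseteq> (SIGMA c:L i - {b}. path_colorings L a i c)"
      by (auto simp: path_colorings_def PiE_def Pi_def)
  qed
  moreover have "finite (SIGMA c:L i - {b}. path_colorings L a i c)"
    using Suc.prems IH by (intro finite_SigmaI) auto
  moreover have "card (SIGMA c:L i - {b}. path_colorings L a i c) = (\<Sum>c\<in>L i - {b}. path_count L a i c)"
    using Suc.prems IH by (subst card_SigmaI) auto
  ultimately show ?case by (metis bij_betw_finite bij_betw_same_card path_count.simps(2))
qed

lemma simple_graph_cycle:
  assumes "n \<ge> 2" shows "simple_graph {0..<n} (snd (cycle_graph n))"
  unfolding simple_graph_def
proof (intro conjI ballI)
  fix e assume "e \<in> snd (cycle_graph n)"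
  then obtain i where i: "i < n" "e = {i, (i + 1) mod n}" by (auto simp: cycle_graph_def)
  moreover have "i \<noteq> (i + 1) mod n" using i(1) assms by (cases "i + 1 = n") auto
  ultimately show "card e = 2" "e \<subseteq> {0..<n}" by auto
qed (use assms in auto)

lemma proper_col_cycle:
  assumes "k \<ge> 1"
  shows "proper_col (snd (cycle_graph (Suc k))) f \<longleftrightarrow> (\<forall>j<k. f j \<noteq> f (Suc j)) \<and> f 0 \<noteq> f k"
  unfolding proper_col_iff[OF simple_graph_cycle[OF Suc_leI[OF le_imp_less_Suc[OF assms], unfolded Suc_1]]]
proof (intro iffI conjI allI impI)
  assume *: "\<forall>u v. {u, v} \<in> snd (cycle_graph (Suc k)) \<longrightarrow> f u \<noteq> f v"
  show "f j \<noteq> f (Suc j)" if "j < k" for j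
  proof -
    have "{j, Suc j} \<in> snd (cycle_graph (Suc k))"
      using that by (auto simp: cycle_graph_def intro!: exI[of _ j])
    then show ?thesis using * by blast
  qed
  have "{k, 0} \<in> snd (cycle_graph (Suc k))"
    by (auto simp: cycle_graph_def intro!: exI[of _ k])
  then show "f 0 \<noteq> f k" using * by metis
next
  fix u v
  assume *: "(\<forall>j<k. f j \<noteq> f (Suc j)) \<and> f 0 \<noteq> f k" and "{u, v} \<in> snd (cycle_graph (Suc k))"
  then obtain i where i: "i < Suc k" "{u, v} = {i, (i + 1) mod Suc k}" by (auto simp: cycle_graph_def)
  show "f u \<noteq> f v"
  proof (cases "i = k")
    case True then show ?thesis using i(2) * by (auto simp: doubleton_eq_iff)
  next
    case False
    then have "f i \<noteq> f (Suc i)" "{u, v} = {i, Suc i}" using i * by auto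
    then show ?thesis by (metis doubleton_eq_iff)
  qed
qed

text \<open>The edge between \<open>k\<close> and \<open>0\<close> only forbids equal end colours of
  the path, hence the range \<open>L k - {a}\<close>.\<close>

lemma num_L_colorings_cycle:
  assumes "k \<ge> 1" "\<And>j. j \<le> k \<Longrightarrow> finite (L j)"
  shows "num_L_colorings {0..<Suc k} (snd (cycle_graph (Suc k))) L =
     (\<Sum>a\<in>L 0. \<Sum>b\<in>L k - {a}. path_count L a k b)"
proof -
  have eq: "{f \<in> Pi\<^sub>E {0..<Suc k} L. proper_col (snd (cycle_graph (Suc k))) f} =
      (\<Union>(a, b)\<in>(SIGMA a:L 0. L k - {a}). path_colorings L a k b)"
    unfolding proper_col_cycle[OF assms(1)] by (auto simp: path_colorings_def atLeast0LessThan lessThan_Suc_atMost)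
  have "num_L_colorings {0..<Suc k} (snd (cycle_graph (Suc k))) L =
      (\<Sum>(a, b)\<in>(SIGMA a:L 0. L k - {a}). card (path_colorings L a k b))"
    unfolding num_L_colorings_def eq using assms card_path_colorings[of k L]
    by (subst card_UN_disjoint) (auto simp: path_colorings_def case_prod_beta)
  also have "\<dots> = (\<Sum>(a, b)\<in>(SIGMA a:L 0. L k - {a}). path_count L a k b)"
    using assms card_path_colorings[of k L] by (intro sum.cong) auto
  also have "\<dots> = (\<Sum>a\<in>L 0. \<Sum>b\<in>L k - {a}. path_count L a k b)"
    using assms by (subst sum.Sigma) auto
  finally show ?thesis .
qed

text \<open>Numbers of walks of length \<open>i\<close> in \<open>K\<^sub>m\<close> from a vertex to itself, respectively to another
  given vertex.\<close>

fun closed_walks :: "nat \<Rightarrow> nat \<Rightarrow> nat" and open_walks :: "nat \<Rightarrow> nat \<Rightarrow> nat" where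
  "closed_walks m 0 = 1"
| "open_walks m 0 = 0"
| "closed_walks m (Suc i) = (m - 1) * open_walks m i"
| "open_walks m (Suc i) = closed_walks m i + (m - 2) * open_walks m i"

text \<open>The difference \<open>closed_walks m i - open_walks m i\<close> is
  \<open>(-1) ^ i\<close>: from counts \<open>c\<close> and \<open>o\<close>, one step leads to the
  difference \<open>(m - 1) * o - (c + (m - 2) * o) = o - c\<close>.\<close>

lemma walks_parity:
  assumes "m \<ge> 2"
  shows "if even i then closed_walks m i = open_walks m i + 1 else open_walks m i = closed_walks m i + 1"
proof (induction i)
  case (Suc i)
  obtain q where "m = Suc (Suc q)" using assms by (metis add_2_eq_Suc le_Suc_ex)
  then show ?case using Suc by (auto split: if_splits)
qed simp

lemma walks_2: "closed_walks 2 i = (if even i then 1 else 0) \<and> open_walks 2 i = (if even i then 0 else 1)"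
  by (induction i) auto

text \<open>For \<open>i = 3\<close>, the length of the path obtained from a 4-cycle, the count is
  \<open>m^2 - 3 * m + 3\<close>. It exceeds \<open>m\<close> by \<open>(m - 1) * (m - 3)\<close>,
  so the bound is attained at \<open>m = 3\<close>.\<close>

lemma open_walks_ge:
  assumes "m \<ge> 3" "i \<ge> 3" shows "open_walks m i \<ge> m"
  using assms(2)
proof (induction i rule: dec_induct)
  case base
  obtain q where q: "m = q + 3" using assms by (metis add.commute le_Suc_ex)
  show ?case by (simp add: q eval_nat_numeral)
next
  case (step i)
  have "1 * open_walks m i \<le> (m - 2) * open_walks m i"
    using assms by (intro mult_right_mono) auto
  then show ?case using step unfolding open_walks.simps by linarith
qed

lemma sum_ge_special:
  fixes x :: "'b \<Rightarrow> nat"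
  assumes "finite S" "s \<in> S" "x s \<ge> e" "\<And>c. c \<in> S \<Longrightarrow> c \<noteq> s \<Longrightarrow> x c \<ge> d"
  shows "sum x S \<ge> e + (card S - 1) * d"
proof -
  have "sum x (S - {s}) \<ge> card (S - {s}) * d"
    using assms sum_bounded_below[of "S - {s}" d x] by simp
  then show ?thesis using assms by (simp add: sum.remove card_Diff_singleton)
qed

lemma sum_ge_const:
  fixes x :: "'b \<Rightarrow> nat"
  assumes "\<And>c. c \<in> S \<Longrightarrow> x c \<ge> d"
  shows "sum x S \<ge> card S * d"
  using assms sum_bounded_below[of S d x] by simp

text \<open>For constant lists, exactly the colour \<open>s = a\<close> attains the bound \<open>closed_walks m i\<close>.
  If the special colour drops out of the next list, a newly appearing colour takes its role.\<close>

lemma path_count_lower: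
  assumes "m \<ge> 2" "\<And>j. j \<le> i \<Longrightarrow> finite (L j) \<and> card (L j) = m" "a \<in> L 0"
  shows "\<exists>s\<in>L i. path_count L a i s \<ge> closed_walks m i \<and>
           (\<forall>b\<in>L i. b \<noteq> s \<longrightarrow> path_count L a i b \<ge> open_walks m i)"
  using assms(2)
proof (induction i)
  case 0
  then show ?case using assms(3) by auto
next
  case (Suc i)
  let ?e = "closed_walks m i" and ?d = "open_walks m i"
  obtain s where s: "s \<in> L i" "path_count L a i s \<ge> ?e"
      "\<And>b. b \<in> L i \<Longrightarrow> b \<noteq> s \<Longrightarrow> path_count L a i b \<ge> ?d"
    using Suc by (metis le_SucI)
  have fin: "finite (L i)" "card (L i) = m" and fin': "finite (L (Suc i))" "card (L (Suc i)) = m"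
    using Suc.prems by auto
  have new: "path_count L a (Suc i) b \<ge> ?e + (m - 1) * ?d" if "b \<notin> L i" for b
    using sum_ge_special[OF fin(1) s(1), of ?e "path_count L a i" ?d] s fin that by simp
  have old: "path_count L a (Suc i) b \<ge> open_walks m (Suc i)" if "b \<noteq> s" for b
  proof (cases "b \<in> L i")
    case True
    then show ?thesis
      using sum_ge_special[of "L i - {b}" s ?e "path_count L a i" ?d] s fin that
      by (simp add: card_Diff_singleton numeral_2_eq_2)
  next
    case False
    have "(m - 2) * ?d \<le> (m - 1) * ?d" by (intro mult_right_mono) auto
    then show ?thesis using new[OF False] unfolding open_walks.simps by linarith
  qed
  show ?case
  proof (cases "s \<in> L (Suc i)")
    case True
    have "path_count L a (Suc i) s \<ge> closed_walks m (Suc i)"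
      using sum_ge_const[of "L i - {s}" ?d "path_count L a i"] s fin by (simp add: card_Diff_singleton)
    then show ?thesis using True old by blast
  next
    case False
    then have "L i \<noteq> L (Suc i)" using s by auto
    then obtain b where b: "b \<in> L (Suc i)" "b \<notin> L i"
      using fin fin' by (metis card_subset_eq subsetI)
    have "path_count L a (Suc i) b \<ge> closed_walks m (Suc i)"
      using new[OF b(2)] unfolding closed_walks.simps by linarith
    then show ?thesis using False old b(1) by metis
  qed
qed

lemma path_count_const:
  assumes "m \<ge> 2" "finite M" "card M = m" "a \<in> M" "b \<in> M" "\<And>j. j < i \<Longrightarrow> L j = M"
  shows "path_count L a i b = (if b = a then closed_walks m i else open_walks m i)"
  using assms(5,6)
proof (induction i arbitrary: b)
  case (Suc i)
  then have IH: "\<And>c. c \<in> M \<Longrightarrow> path_count L a i c = (if c = a then closed_walks m i else open_walks m i)"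
    and [simp]: "L i = M" by auto
  have eq: "path_count L a (Suc i) b = (\<Sum>c\<in>M - {b}. if c = a then closed_walks m i else open_walks m i)"
    using IH by simp
  show ?case
  proof (cases "b = a")
    case True
    have "(\<Sum>c\<in>M - {b}. if c = a then closed_walks m i else open_walks m i) = (\<Sum>c\<in>M - {b}. open_walks m i)"
      using True by (intro sum.cong) auto
    then show ?thesis using True eq assms Suc.prems by (simp add: card_Diff_singleton)
  next
    case False
    have "(\<Sum>c\<in>M - {b} - {a}. if c = a then closed_walks m i else open_walks m i)
        = (\<Sum>c\<in>M - {b} - {a}. open_walks m i)"
      by (intro sum.cong) auto
    moreover have "card (M - {b} - {a}) = m - 2"
      using False assms Suc.prems by (simp add: card_Diff_singleton)
    ultimately show ?thesis using False eq assms Suc.prems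
      by (simp add: sum.remove[of "M - {b}" a])
  qed
qed simp

text \<open>For \<open>m = 2\<close> the first change of the lists frees one of the two starting colours.\<close>

lemma path_count_2:
  assumes "\<And>j. j \<le> i \<Longrightarrow> finite (L j) \<and> card (L j) = 2"
  shows "(\<forall>j\<le>i. L j = L 0) \<or> (\<exists>s\<in>L 0. \<forall>b\<in>L i. path_count L s i b \<ge> 1)"
  using assms
proof (induction i)
  case (Suc i)
  have fin: "finite (L i)" "card (L i) = 2" "finite (L (Suc i))" "card (L (Suc i)) = 2"
    "finite (L 0)" "card (L 0) = 2"
    using Suc.prems by auto
  consider "\<forall>j\<le>Suc i. L j = L 0" | "\<forall>j\<le>i. L j = L 0" "L (Suc i) \<noteq> L 0"
    | s where "s \<in> L 0" "\<forall>b\<in>L i. path_count L s i b \<ge> 1"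
    using Suc by (metis le_SucI le_Suc_eq)
  then show ?case
  proof cases
    case 2
    then obtain p where p: "p \<in> L 0" "p \<notin> L (Suc i)"
      using fin by (metis card_subset_eq subsetI)
    obtain p' where p': "p' \<in> L 0" "p' \<noteq> p"
      using fin card_mono[of "{p}" "L 0"] by fastforce
    \<comment> \<open>With only the colours \<open>p\<close> and \<open>p'\<close> up to vertex
      \<open>i\<close> the path alternates, and \<open>s\<close> is the start that puts
      \<open>p\<close> on vertex \<open>i\<close>. As \<open>p\<close> is missing from the next
      list, every colour there can follow.\<close>
    define s where "s = (if even i then p else p')"
    have "s \<in> L 0" using p p' by (simp add: s_def)
    have "path_count L s i p = 1"
    proof -
      have "path_count L s i p = (if p = s then closed_walks 2 i else open_walks 2 i)"
        by (rule path_count_const[OF order_refl fin(5,6) \<open>s \<in> L 0\<close> p(1)])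
          (rule 2(1)[rule_format, OF less_imp_le])
      then show ?thesis using p'(2) walks_2[of i] by (simp add: s_def split: if_splits)
    qed
    moreover have "path_count L s i p \<le> path_count L s (Suc i) b" if "b \<in> L (Suc i)" for b
    proof -
      have "p \<in> L i" using p(1) 2(1)[rule_format, of i] by simp
      then have "p \<in> L i - {b}" using p(2) that by auto
      then show ?thesis using fin(1) by (auto intro!: member_le_sum)
    qed
    ultimately show ?thesis using \<open>s \<in> L 0\<close> by metis
  next
    case 3
    have "path_count L s (Suc i) b \<ge> 1" for b
    proof -
      obtain c where "c \<in> L i - {b}" using fin card_mono[of "{b}" "L i"] by fastforce
      then have "path_count L s i c \<le> path_count L s (Suc i) b"
        using fin by (auto intro!: member_le_sum)
      then show ?thesis using 3 \<open>c \<in> L i - {b}\<close> by fastforce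
    qed
    then show ?thesis using 3 by blast
  qed blast
qed simp

lemma num_L_colorings_cycle_const:
  assumes "k \<ge> 1" "m \<ge> 2" "finite M" "card M = m" "\<And>j. j \<le> k \<Longrightarrow> L j = M"
  shows "num_L_colorings {0..<Suc k} (snd (cycle_graph (Suc k))) L = m * ((m - 1) * open_walks m k)"
proof -
  have "num_L_colorings {0..<Suc k} (snd (cycle_graph (Suc k))) L =
     (\<Sum>a\<in>M. \<Sum>b\<in>M - {a}. path_count L a k b)"
    using num_L_colorings_cycle[of k L] assms by simp
  also have "\<dots> = (\<Sum>a\<in>M. \<Sum>b\<in>M - {a}. open_walks m k)"
    using path_count_const[OF assms(2-4), where L = L and i = k] assms(5) by (intro sum.cong refl) auto
  also have "\<dots> = m * ((m - 1) * open_walks m k)"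
    using assms by (simp add: card_Diff_singleton)
  finally show ?thesis .
qed

text \<open>Let \<open>e\<close> and \<open>d\<close> be the numbers of closed and open walks of
  length \<open>k\<close>; since \<open>k\<close> is odd, \<open>d = e + 1\<close>. Constant lists
  give \<open>(m - 1) * d\<close> for each start colour. Here a start colour in \<open>L k\<close>
  may fall short of this by one, if the low count sits at a colour that is not removed, while a
  start colour outside \<open>L k\<close> exceeds it by at least \<open>e\<close>. For
  \<open>m = 2\<close> one has \<open>e = 0\<close>, and \<open>path_count_2\<close> is used
  instead.\<close>

lemma num_L_colorings_cycle_nonconst:
  assumes k: "odd k" "k \<ge> 3" and m: "m \<ge> 2"
    and L: "\<And>j. j \<le> k \<Longrightarrow> finite (L j) \<and> card (L j) = m" and ne: "L 0 \<noteq> L k"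
  shows "num_L_colorings {0..<Suc k} (snd (cycle_graph (Suc k))) L \<ge> m * ((m - 1) * open_walks m k)"
proof -
  let ?e = "closed_walks m k" and ?d = "open_walks m k"
  let ?T = "\<lambda>a. \<Sum>b\<in>L k - {a}. path_count L a k b"
  have fin: "finite (L 0)" "card (L 0) = m" "finite (L k)" "card (L k) = m" using L by auto
  have num: "num_L_colorings {0..<Suc k} (snd (cycle_graph (Suc k))) L = sum ?T (L 0)"
    using num_L_colorings_cycle[of k L] k L by simp
  have d: "?d = ?e + 1" using walks_parity[OF m, of k] k by simp
  obtain a0 where a0: "a0 \<in> L 0" "a0 \<notin> L k" using ne fin by (metis card_subset_eq subsetI)
  have T: "?T a \<ge> (if a \<in> L k then ?e + (m - 2) * ?d else ?e + (m - 1) * ?d)" if a: "a \<in> L 0" for a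
  proof -
    obtain s where s: "s \<in> L k" "path_count L a k s \<ge> ?e"
      "\<And>b. b \<in> L k \<Longrightarrow> b \<noteq> s \<Longrightarrow> path_count L a k b \<ge> ?d"
      using path_count_lower[of m k L a] m L a by blast
    consider "a \<notin> L k" | "a = s" | "a \<in> L k" "a \<noteq> s" by blast
    then show ?thesis
    proof cases
      case 1
      then show ?thesis
        using sum_ge_special[OF fin(3) s(1), of ?e "path_count L a k" ?d] s fin by simp
    next
      case 2
      have "?T a \<ge> (m - 1) * ?d"
        using sum_ge_const[of "L k - {s}" ?d "path_count L a k"] s fin 2
        by (simp add: card_Diff_singleton)
      moreover have "(m - 1) * ?d = ?d + (m - 2) * ?d"
        using m by (metis Suc_1 Suc_diff_Suc Suc_le_lessD mult_Suc One_nat_def diff_Suc_1)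
      ultimately show ?thesis using 2 s(1) d by simp
    next
      case 3
      then show ?thesis
        using sum_ge_special[of "L k - {a}" s ?e "path_count L a k" ?d] s fin
        by (simp add: card_Diff_singleton numeral_2_eq_2)
    qed
  qed
  show ?thesis
  proof (cases "m = 2")
    case False
    then have "m \<ge> 3" using m by simp
    then obtain q where q: "m = q + 3" by (metis add.commute le_Suc_ex)
    have lower: "sum ?T (L 0) \<ge> (?e + (m - 1) * ?d) + (card (L 0) - 1) * (?e + (m - 2) * ?d)"
    proof (rule sum_ge_special[OF fin(1) a0(1)])
      show "?T a0 \<ge> ?e + (m - 1) * ?d" using T[OF a0(1)] a0(2) by simp
      fix c assume c: "c \<in> L 0"
      have "(m - 2) * ?d \<le> (m - 1) * ?d" by (intro mult_right_mono) auto
      then have "?e + (m - 2) * ?d \<le> (if c \<in> L k then ?e + (m - 2) * ?d else ?e + (m - 1) * ?d)"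
        by auto
      also note T[OF c]
      finally show "?T c \<ge> ?e + (m - 2) * ?d" .
    qed
    have "m \<le> ?d" using open_walks_ge[OF \<open>m \<ge> 3\<close> k(2)] .
    \<comment> \<open>The surplus \<open>e\<close> of \<open>a0\<close> has to cover a deficit of
      one for each of the other \<open>m - 1\<close> start colours, and
      \<open>e = d - 1 >= m - 1\<close>.\<close>
    have "m * ((m - 1) * y) \<le> (x + (m - 1) * y) + (m - 1) * (x + (m - 2) * y)"
      if "y = x + 1" "m \<le> y" for x y
      using that(2) unfolding that(1) q by (simp add: algebra_simps)
    from this[OF d \<open>m \<le> ?d\<close>]
    show ?thesis unfolding num using lower unfolding fin(2) by (rule order_trans)
  next
    case True
    have w: "?e = 0" "?d = 1" using walks_2[of k] k True by auto
    obtain s where s: "s \<in> L 0" "\<And>b. b \<in> L k \<Longrightarrow> path_count L s k b \<ge> 1"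
      using path_count_2[of k L] L True ne by auto
    \<comment> \<open>If \<open>s = a0\<close>, both end colours are reachable and none is removed;
      otherwise \<open>a0\<close> and \<open>s\<close> contribute at least one colouring
      each.\<close>
    have "sum ?T (L 0) \<ge> 2"
    proof (cases "s = a0")
      case s0: True
      have "?T a0 \<ge> 2"
        using sum_ge_const[of "L k" 1 "path_count L s k"] s fin a0 s0 True by simp
      moreover have "?T a0 \<le> sum ?T (L 0)" using fin a0 by (intro member_le_sum) auto
      ultimately show ?thesis by simp
    next
      case False
      have "?T a0 \<ge> 1" using T[OF a0(1)] a0(2) w True by simp
      moreover have "card (L k - {s}) \<ge> 1" using fin True by (simp add: card_Diff_singleton_if)
      then have "?T s \<ge> 1"
        using sum_ge_const[of "L k - {s}" 1 "path_count L s k"] s by fastforce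
      moreover have "sum ?T {a0, s} \<le> sum ?T (L 0)" using fin a0 s by (intro sum_mono2) auto
      ultimately show ?thesis using False by simp
    qed
    then show ?thesis unfolding num using w True by simp
  qed
qed

lemma cycle_lists_change:
  assumes n: "n \<ge> 1" and "\<not> (\<forall>j<n. L j = L 0)"
  shows "\<exists>i<n. L i \<noteq> L (Suc i mod n)"
proof (rule ccontr)
  assume "\<not> (\<exists>i<n. L i \<noteq> L (Suc i mod n))"
  then have *: "\<forall>i<n. L i = L (Suc i mod n)" by blast
  have "L j = L 0" if "j < n" for j
    using that
  proof (induction j)
    case (Suc j)
    then have "L j = L (Suc j mod n)" "L j = L 0" using * Suc_lessD by blast+
    then show ?case using Suc.prems by (metis mod_less)
  qed simp
  then show False using assms by blast
qed

lemma count_minimal_even_cycle: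
  assumes k: "k \<ge> 1" and m: "m \<ge> 2"
  shows "count_minimal (cycle_graph (2 * k + 2)) m"
  unfolding count_minimal_def
proof (intro allI impI)
  define l where "l = 2 * k + 1"
  define E where "E = snd (cycle_graph (Suc l))"
  have n: "2 * k + 2 = Suc l" and l: "odd l" "l \<ge> 3" using k by (auto simp: l_def)
  have V: "fst (cycle_graph (Suc l)) = {0..<Suc l}" by (simp add: cycle_graph_def)
  have G: "simple_graph {0..<Suc l} E" unfolding E_def using l by (intro simple_graph_cycle) simp
  fix L assume "m_assignment (fst (cycle_graph (2 * k + 2))) m L"
  then have L: "\<And>j. j \<le> l \<Longrightarrow> finite (L j) \<and> card (L j) = m"
    unfolding n V m_assignment_def by auto
  have chrom: "chrom_poly {0..<Suc l} E m = m * ((m - 1) * open_walks m l)"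
    unfolding chrom_poly_def E_def by (rule num_L_colorings_cycle_const) (use l m in auto)
  have "m * ((m - 1) * open_walks m l) \<le> num_L_colorings {0..<Suc l} E L"
  proof (cases "\<forall>j<Suc l. L j = L 0")
    case True
    have "num_L_colorings {0..<Suc l} E L = m * ((m - 1) * open_walks m l)"
      unfolding E_def
    proof (rule num_L_colorings_cycle_const[OF _ m, where M = "L 0"])
      show "L j = L 0" if "j \<le> l" for j using True that less_Suc_eq_le by blast
    qed (use l L[of 0] in auto)
    then show ?thesis by simp
  next
    case False
    then obtain i where i: "i < Suc l" "L i \<noteq> L (Suc i mod Suc l)"
      using cycle_lists_change[of "Suc l" L] by auto
    \<comment> \<open>The rotation sends \<open>l\<close> to \<open>i\<close> and \<open>0\<close>
      to the successor of \<open>i\<close>, so the lists at the two ends of the cut path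
      differ.\<close>
    define \<phi> where "\<phi> j = (j + Suc i) mod Suc l" for j
    have inj: "inj_on \<phi> {0..<Suc l}"
    proof (rule linorder_inj_onI)
      fix x y assume xy: "x < y" "x \<in> {0..<Suc l}" "y \<in> {0..<Suc l}"
      then have "\<not> Suc l dvd (y + Suc i) - (x + Suc i)" by (auto dest: dvd_imp_le)
      then have "\<phi> y \<noteq> \<phi> x"
        unfolding \<phi>_def using xy(1) by (subst mod_eq_dvd_iff_nat) auto
      then show "\<phi> x \<noteq> \<phi> y" by simp
    qed auto
    have "\<phi> ` {0..<Suc l} \<subseteq> {0..<Suc l}" by (auto simp: \<phi>_def)
    then have \<phi>: "bij_betw \<phi> {0..<Suc l} {0..<Suc l}"
      using inj endo_inj_surj[of "{0..<Suc l}" \<phi>] by (auto simp: bij_betw_def)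
    have step: "\<phi> ((j + 1) mod Suc l) = (\<phi> j + 1) mod Suc l" for j
      unfolding \<phi>_def mod_add_left_eq by (simp only: ac_simps)
    have adj: "{u, v} \<in> E \<longleftrightarrow> {\<phi> u, \<phi> v} \<in> E" if "u \<in> {0..<Suc l}" "v \<in> {0..<Suc l}" for u v
    proof -
      have E: "{u, v} \<in> E \<longleftrightarrow> v = (u + 1) mod Suc l \<or> u = (v + 1) mod Suc l"
        if "u < Suc l" "v < Suc l" for u v
        using that by (auto simp: E_def cycle_graph_def doubleton_eq_iff)
      have lt: "(u + 1) mod Suc l \<in> {0..<Suc l}" for u by simp
      have "v = (u + 1) mod Suc l \<longleftrightarrow> \<phi> v = (\<phi> u + 1) mod Suc l"
        "u = (v + 1) mod Suc l \<longleftrightarrow> \<phi> u = (\<phi> v + 1) mod Suc l"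
        unfolding step[symmetric] using inj_on_eq_iff[OF inj] that lt by blast+
      then show ?thesis using E[of u v] E[of "\<phi> u" "\<phi> v"] that by (simp add: \<phi>_def)
    qed
    have "num_L_colorings {0..<Suc l} E L = num_L_colorings {0..<Suc l} E (\<lambda>j. L (\<phi> j))"
      by (rule num_L_colorings_iso[OF G G \<phi> adj, symmetric])
    also have "\<dots> \<ge> m * ((m - 1) * open_walks m l)"
      unfolding E_def
    proof (rule num_L_colorings_cycle_nonconst[OF l m])
      show "finite (L (\<phi> j)) \<and> card (L (\<phi> j)) = m" for j
        using L[of "\<phi> j"] by (simp add: \<phi>_def less_Suc_eq_le[symmetric])
      have "l + Suc i = Suc l + i" by simp
      then have "\<phi> l = i" using i(1) unfolding \<phi>_def by (simp only: mod_add_self1 mod_less)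
      then show "L (\<phi> 0) \<noteq> L (\<phi> l)" using i(2) by (simp add: \<phi>_def)
    qed
    finally show ?thesis .
  qed
  then show "chrom_poly (fst (cycle_graph (2 * k + 2))) (snd (cycle_graph (2 * k + 2))) m
      \<le> num_L_colorings (fst (cycle_graph (2 * k + 2))) (snd (cycle_graph (2 * k + 2))) L"
    unfolding n V E_def[symmetric] chrom .
qed

section \<open>The graph \<open>K\<^sub>2\<^sub>,\<^sub>3\<close>\<close>

text \<open>The excess of \<open>card (S - {a, b})\<close> over its least possible value
  \<open>card S - 2\<close>: one for each of \<open>a\<close> and \<open>b\<close> outside
  \<open>S\<close>, and one if they coincide inside \<open>S\<close>.\<close>

definition spare :: "'c set \<Rightarrow> 'c \<Rightarrow> 'c \<Rightarrow> nat" where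
  "spare S a b = of_bool (a \<notin> S) + of_bool (b \<notin> S) + of_bool (a = b \<and> a \<in> S)"

lemma card_Diff_pair:
  assumes "finite S" "card S = q + 2"
  shows "card (S - {a, b}) = q + spare S a b"
proof -
  have "card (S - {a} - {b}) = q + spare S a b"
    using assms by (auto simp: card_Diff_singleton_if spare_def)
  then show ?thesis by (simp add: Diff_insert2[symmetric] insert_commute)
qed

lemma spare_commute: "spare S a b = spare S b a"
  by (auto simp: spare_def)

lemma spare_diag: "spare S a a \<ge> 1"
  by (auto simp: spare_def)

lemma spare_eq_0_iff: "spare S a b = 0 \<longleftrightarrow> a \<in> S \<and> b \<in> S \<and> a \<noteq> b"
  by (auto simp: spare_def)

lemma ex_not_mem_card_eq:
  assumes "finite A" "finite B" "card A = card B" "A \<noteq> B"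
  shows "\<exists>a\<in>A. a \<notin> B"
  using assms by (metis card_subset_eq subsetI)

text \<open>In the row of \<open>a0\<close> all \<open>m\<close> entries are positive. Each of the
  other \<open>m - 1\<close> rows has at least one positive entry: at a colour of \<open>B\<close>
  outside \<open>S\<close> or, if \<open>B = S\<close>, at \<open>b = a\<close>, unless
  \<open>a\<close> lies outside \<open>S\<close> and the whole row is positive.\<close>

lemma sum_spare_ge_aux:
  assumes "finite A" "finite B" "finite S" "card A = m" "card B = m" "card S = m"
    and a0: "a0 \<in> A" "a0 \<notin> S"
  shows "(\<Sum>a\<in>A. \<Sum>b\<in>B. spare S a b) \<ge> 2 * m - 1"
proof -
  have "(\<Sum>b\<in>B. spare S a0 b) \<ge> m"
    using sum_ge_const[of B 1 "spare S a0"] a0 assms by (simp add: spare_def)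
  moreover have "(\<Sum>b\<in>B. spare S a b) \<ge> 1" if a: "a \<in> A" for a
  proof -
    have "\<exists>b\<in>B. spare S a b \<ge> 1"
    proof (cases "B = S")
      case True
      have "B \<noteq> {}" using assms by auto
      then show ?thesis using True spare_diag[of S a] by (cases "a \<in> S") (auto simp: spare_def)
    next
      case False
      then obtain b where "b \<in> B" "b \<notin> S" using ex_not_mem_card_eq[of B S] assms by auto
      then show ?thesis by (intro bexI[of _ b]) (auto simp: spare_def)
    qed
    then obtain b where "b \<in> B" "spare S a b \<ge> 1" by blast
    moreover from this have "spare S a b \<le> (\<Sum>b\<in>B. spare S a b)"
      using assms by (intro member_le_sum) auto
    ultimately show ?thesis by linarith
  qed
  ultimately have "(\<Sum>a\<in>A. \<Sum>b\<in>B. spare S a b) \<ge> m + (card A - 1) * 1"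
    using assms by (intro sum_ge_special[where s = a0]) auto
  then show ?thesis using assms by linarith
qed

lemma sum_spare_ge:
  assumes "finite A" "finite B" "finite S" "card A = m" "card B = m" "card S = m" "A \<noteq> B"
  shows "(\<Sum>a\<in>A. \<Sum>b\<in>B. spare S a b) \<ge> 2 * m - 1"
proof (cases "A = S")
  case False
  then obtain a0 where "a0 \<in> A" "a0 \<notin> S" using ex_not_mem_card_eq[of A S] assms by auto
  then show ?thesis using sum_spare_ge_aux[of A B S m] assms by simp
next
  case True
  then obtain b0 where "b0 \<in> B" "b0 \<notin> S" using ex_not_mem_card_eq[of B S] assms by auto
  then have "(\<Sum>b\<in>B. \<Sum>a\<in>A. spare S b a) \<ge> 2 * m - 1"
    using sum_spare_ge_aux[of B A S m] assms by simp
  moreover have "(\<Sum>b\<in>B. \<Sum>a\<in>A. spare S b a) = (\<Sum>a\<in>A. \<Sum>b\<in>B. spare S a b)"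
    by (subst sum.swap) (simp add: spare_commute)
  ultimately show ?thesis by simp
qed

text \<open>Two common colours of \<open>A\<close> and \<open>B\<close> give at least one each on
  the diagonal. Otherwise \<open>A \<union> B\<close> has at least five colours, so \<open>S\<close>
  and \<open>T\<close> each miss at least two of them, and these missing colours already give
  enough.\<close>

lemma sum_two_spares_ge:
  assumes "finite A" "finite B" "finite S" "finite T"
    and card: "card A = 3" "card B = 3" "card S = 3" "card T = 3"
  shows "(\<Sum>a\<in>A. \<Sum>b\<in>B. spare S a b * spare T a b) \<ge> 2"
proof (cases "card (A \<inter> B) \<ge> 2")
  case True
  have "(\<Sum>b\<in>B. spare S a b * spare T a b) \<ge> of_bool (a \<in> B)" for a
  proof (cases "a \<in> B")
    case True
    have "1 * 1 \<le> spare S a a * spare T a a" by (intro mult_mono spare_diag) auto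
    also have "\<dots> \<le> (\<Sum>b\<in>B. spare S a b * spare T a b)"
      using True assms by (intro member_le_sum) auto
    finally show ?thesis by simp
  qed simp
  then have "(\<Sum>a\<in>A. \<Sum>b\<in>B. spare S a b * spare T a b) \<ge> (\<Sum>a\<in>A. of_bool (a \<in> B))"
    by (intro sum_mono) auto
  also have "(\<Sum>a\<in>A. of_bool (a \<in> B)) = card (A \<inter> B)" using assms by simp
  finally show ?thesis using True by simp
next
  case False
  have un: "card (A \<union> B) \<ge> 5" using card_Un_Int[of A B] assms False by simp
  have missing: "card (A - S) + card (B - S) \<ge> 2" if "finite S" "card S = 3" for S :: "'a set"
  proof -
    have "card (A \<union> B) - card S \<le> card (A \<union> B - S)" using that by (intro diff_card_le_card_Diff)
    also have "\<dots> \<le> card (A - S) + card (B - S)" by (simp add: Un_Diff card_Un_le)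
    finally show ?thesis using un that by simp
  qed
  \<comment> \<open>Without its term for \<open>a = b\<close>, \<open>spare\<close> is a function of
    \<open>a\<close> plus a function of \<open>b\<close>, so the double sum factors. The factor 3 is
    the number of values of the variable that does not occur.\<close>
  have split: "(\<Sum>a\<in>A. \<Sum>b\<in>B. (of_bool (a \<notin> S) + of_bool (b \<notin> S)) * (of_bool (a \<notin> T) + of_bool (b \<notin> T)))
     = 3 * card ((A - S) \<inter> (A - T)) + card (A - S) * card (B - T) + card (A - T) * card (B - S)
        + 3 * card ((B - S) \<inter> (B - T))"
  proof -
    have card_of_bool: "(\<Sum>x\<in>X. of_bool (P x) :: nat) = card {x \<in> X. P x}" if "finite X" for X :: "'a set" and P
      using that by (simp add: Collect_conj_eq Int_commute)
    have "(\<Sum>a\<in>A. \<Sum>b\<in>B. (of_bool (a \<notin> S) + of_bool (b \<notin> S)) * (of_bool (a \<notin> T) + of_bool (b \<notin> T)))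
      = (\<Sum>a\<in>A. \<Sum>b\<in>B. of_bool (a \<notin> S \<and> a \<notin> T) + of_bool (a \<notin> S) * of_bool (b \<notin> T)
          + of_bool (a \<notin> T) * of_bool (b \<notin> S) + (of_bool (b \<notin> S \<and> b \<notin> T) :: nat))"
      by (intro sum.cong refl) auto
    also have "\<dots> = (\<Sum>a\<in>A. \<Sum>b\<in>B. of_bool (a \<notin> S \<and> a \<notin> T))
       + (\<Sum>a\<in>A. of_bool (a \<notin> S)) * (\<Sum>b\<in>B. of_bool (b \<notin> T))
       + (\<Sum>a\<in>A. of_bool (a \<notin> T)) * (\<Sum>b\<in>B. of_bool (b \<notin> S))
       + (\<Sum>a\<in>A. \<Sum>b\<in>B. of_bool (b \<notin> S \<and> b \<notin> T))"
      by (simp only: sum.distrib sum_product)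
    also have "(\<Sum>a\<in>A. \<Sum>b\<in>B. of_bool (a \<notin> S \<and> a \<notin> T)) = 3 * (\<Sum>a\<in>A. of_bool (a \<notin> S \<and> a \<notin> T) :: nat)"
      using card by (simp only: sum_constant sum_distrib_left of_nat_id)
    also have "(\<Sum>a\<in>A. \<Sum>b\<in>B. of_bool (b \<notin> S \<and> b \<notin> T)) = 3 * (\<Sum>b\<in>B. of_bool (b \<notin> S \<and> b \<notin> T) :: nat)"
      using card by (simp only: sum_constant of_nat_id)
    finally show ?thesis
      using assms by (simp only: card_of_bool set_diff_eq Int_def mem_Collect_eq) (simp add: conj_ac cong: conj_cong)
  qed
  let ?x = "card (A - S)" and ?x' = "card (A - T)" and ?y = "card (B - S)" and ?y' = "card (B - T)"
  have bounds: "?x + ?y \<ge> 2" "?x' + ?y' \<ge> 2" using missing assms by auto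
  have "3 * card ((A - S) \<inter> (A - T)) + ?x * ?y' + ?x' * ?y + 3 * card ((B - S) \<inter> (B - T)) \<ge> 2"
  proof (cases "(A - S) \<inter> (A - T) = {} \<and> (B - S) \<inter> (B - T) = {}")
    case True
    have "?x + ?x' \<le> 3" "?y + ?y' \<le> 3"
      using True assms card_Un_disjoint[of "A - S" "A - T"] card_Un_disjoint[of "B - S" "B - T"]
        card_mono[of A "(A - S) \<union> (A - T)"] card_mono[of B "(B - S) \<union> (B - T)"] by auto
    then have "?x \<in> {0, 1, 2, 3}" "?x' \<in> {0, 1, 2, 3}" "?y \<in> {0, 1, 2, 3}" "?y' \<in> {0, 1, 2, 3}"
      by auto
    \<comment> \<open>Write \<open>x, x', y, y'\<close> for the four cardinalities. If, for
      instance, \<open>y = 0\<close>, then \<open>x >= 2\<close>, hence \<open>x' <= 1\<close> and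
      \<open>y' >= 1\<close>. The remaining values are checked one by one.\<close>
    then have "?x * ?y' + ?x' * ?y \<ge> 2"
      using bounds \<open>?x + ?x' \<le> 3\<close> \<open>?y + ?y' \<le> 3\<close> by auto
    then show ?thesis by linarith
  next
    case False
    then have "card ((A - S) \<inter> (A - T)) > 0 \<or> card ((B - S) \<inter> (B - T)) > 0"
      using assms by (auto simp: card_gt_0_iff)
    then show ?thesis by linarith
  qed
  also have "3 * card ((A - S) \<inter> (A - T)) + ?x * ?y' + ?x' * ?y + 3 * card ((B - S) \<inter> (B - T))
      \<le> (\<Sum>a\<in>A. \<Sum>b\<in>B. spare S a b * spare T a b)"
    unfolding split[symmetric] by (intro sum_mono mult_mono) (auto simp: spare_def)
  finally show ?thesis .
qed

text \<open>A pair \<open>(a, b)\<close> contributes zero only if \<open>a\<close> and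
  \<open>b\<close> differ and some \<open>S j\<close> equals \<open>{a, b}\<close>. For disjoint
  \<open>A\<close> and \<open>B\<close> the four pairs would need four different lists, so three
  lists leave a pair; four lists can block all pairs, as in \<open>rigid_K24\<close>. A list that
  blocks the opposite pair avoids both colours of the remaining pair and doubles its weight. If
  \<open>A\<close> and \<open>B\<close> share \<open>d\<close>, either \<open>(d, d)\<close> and the
  pair of the other two colours both count, or some list avoids \<open>d\<close> and
  \<open>(d, d)\<close> has weight at least two.\<close>

lemma sum_three_spares_ge:
  fixes S :: "nat \<Rightarrow> 'c set"
  assumes fin: "finite A" "finite B" "\<And>j. j < 3 \<Longrightarrow> finite (S j)"
    and card: "card A = 2" "card B = 2" "\<And>j. j < 3 \<Longrightarrow> card (S j) = 2" and ne: "A \<noteq> B"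
  shows "(\<Sum>a\<in>A. \<Sum>b\<in>B. \<Prod>j<3. spare (S j) a b) \<ge> 2"
proof -
  let ?p = "\<lambda>(a, b). \<Prod>j<3. spare (S j) a b"
  have total: "(\<Sum>a\<in>A. \<Sum>b\<in>B. \<Prod>j<3. spare (S j) a b) = sum ?p (A \<times> B)"
    using fin by (simp add: sum.cartesian_product)
  have two: "sum ?p (A \<times> B) \<ge> 2"
    if "x \<in> A \<times> B" "y \<in> A \<times> B" "x \<noteq> y" "?p x \<ge> 1" "?p y \<ge> 1" for x y
  proof -
    have "sum ?p {x, y} \<le> sum ?p (A \<times> B)" using that fin by (intro sum_mono2) auto
    then show ?thesis using that by simp
  qed
  have double: "sum ?p (A \<times> B) \<ge> 2"
    if "(a, b) \<in> A \<times> B" "\<And>j. j < 3 \<Longrightarrow> spare (S j) a b \<ge> 1" "i < 3" "spare (S i) a b \<ge> 2" for a b i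
  proof -
    have "2 * 1 \<le> spare (S i) a b * (\<Prod>j\<in>{..<3} - {i}. spare (S j) a b)"
      using that by (intro mult_mono prod_ge_1) auto
    also have "\<dots> = ?p (a, b)" using that(3) by (simp add: prod.remove[of "{..<3}" i])
    also have "\<dots> \<le> sum ?p (A \<times> B)" using that(1) fin by (intro member_le_sum) auto
    finally show ?thesis by simp
  qed
  have pos: "?p (a, b) \<ge> 1" if "\<And>j. j < 3 \<Longrightarrow> spare (S j) a b \<ge> 1" for a b
    unfolding prod.case using that by (intro prod_ge_1) simp
  show ?thesis
  proof (cases "A \<inter> B = {}")
    case False
    then obtain d where d: "d \<in> A" "d \<in> B" by blast
    obtain a where a: "a \<in> A" "a \<notin> B" using ex_not_mem_card_eq[of A B] fin card ne by auto
    obtain b where b: "b \<in> B" "b \<notin> A" using ex_not_mem_card_eq[of B A] fin card ne by auto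
    show ?thesis
    proof (cases "\<forall>j<3. d \<in> S j")
      case True
      have "spare (S j) a b \<ge> 1" if j: "j < 3" for j
      proof (rule ccontr)
        assume "\<not> spare (S j) a b \<ge> 1"
        then have "{d, a, b} \<subseteq> S j" using True j spare_eq_0_iff[of "S j" a b] by auto
        then have "card {d, a, b} \<le> 2" using card_mono fin(3)[OF j] card(3)[OF j] by metis
        moreover have "d \<noteq> a" "d \<noteq> b" "a \<noteq> b" using d a b by auto
        then have "card {d, a, b} = 3" by simp
        ultimately show False by simp
      qed
      then have "?p (a, b) \<ge> 1" by (rule pos)
      moreover have "?p (d, d) \<ge> 1" by (rule pos) (rule spare_diag)
      moreover have "(d, d) \<in> A \<times> B" "(a, b) \<in> A \<times> B" "(d, d) \<noteq> (a, b)" using d a b by auto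
      ultimately show ?thesis unfolding total using two by blast
    next
      case False
      then obtain i where "i < 3" "d \<notin> S i" by blast
      then show ?thesis
        unfolding total using double[of d d i] d spare_diag[of _ d] by (auto simp: spare_def)
    qed
  next
    case disj: True
    have S_eq: "S j = {a, b}" if "j < 3" "a \<in> A" "b \<in> B" "spare (S j) a b = 0" for j a b
    proof -
      have "{a, b} \<subseteq> S j" "card {a, b} = 2" using that spare_eq_0_iff[of "S j" a b] by auto
      then show ?thesis using fin(3)[OF that(1)] card(3)[OF that(1)] by (metis card_subset_eq)
    qed
    have "\<exists>x\<in>A \<times> B. \<forall>j<3. spare (S j) (fst x) (snd x) \<ge> 1"
    proof (rule ccontr)
      assume "\<not> ?thesis"
      then have "\<forall>x\<in>A \<times> B. \<exists>j<3. spare (S j) (fst x) (snd x) = 0" by (simp add: not_le)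
      then obtain k where k: "\<And>x. x \<in> A \<times> B \<Longrightarrow> k x < 3 \<and> spare (S (k x)) (fst x) (snd x) = 0"
        by metis
      have "inj_on k (A \<times> B)"
      proof (rule inj_onI)
        fix x y assume xy: "x \<in> A \<times> B" "y \<in> A \<times> B" "k x = k y"
        then have "{fst x, snd x} = {fst y, snd y}"
          using S_eq[of "k x" "fst x" "snd x"] S_eq[of "k y" "fst y" "snd y"] k[of x] k[of y] by auto
        then show "x = y" using xy disj by (auto simp: doubleton_eq_iff prod_eq_iff)
      qed
      then have "card (A \<times> B) \<le> card {..<3::nat}"
        using k by (intro card_inj_on_le[of k]) auto
      then show False using card by (simp add: card_cartesian_product)
    qed
    then obtain a b where ab: "a \<in> A" "b \<in> B" "\<And>j. j < 3 \<Longrightarrow> spare (S j) a b \<ge> 1" by auto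
    obtain a' where a': "a' \<in> A" "a' \<noteq> a" using card_mono[of "{a}" A] card by fastforce
    obtain b' where b': "b' \<in> B" "b' \<noteq> b" using card_mono[of "{b}" B] card by fastforce
    show ?thesis
    proof (cases "\<forall>j<3. spare (S j) a' b' \<ge> 1")
      case True
      then show ?thesis unfolding total using two[of "(a, b)" "(a', b')"] pos ab a' b' by auto
    next
      case False
      then obtain i where i: "i < 3" "spare (S i) a' b' = 0" by (auto simp: not_le)
      then have "S i = {a', b'}" using S_eq a' b' by blast
      then have "spare (S i) a b \<ge> 2" using ab a' b' disj by (auto simp: spare_def)
      then show ?thesis unfolding total using double[of a b i] ab i by auto
    qed
  qed
qed

text \<open>With \<open>q = m - 2\<close>, expand the product of the factors \<open>q + spare (S j) a b\<close> in powers of \<open>q\<close>.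
  If \<open>A \<noteq> B\<close>, the linear terms \<open>spare (S j) a b\<close> alone give enough for \<open>q \<ge> 2\<close>; for \<open>q = 1\<close> the
  products of two of them are needed as well, and for \<open>q = 0\<close> only the product of all three is left.\<close>

lemma sum_prod_card_ge:
  fixes S :: "nat \<Rightarrow> 'c set"
  assumes m: "m \<ge> 2"
    and fin: "finite A" "finite B" "\<And>j. j < 3 \<Longrightarrow> finite (S j)"
    and card: "card A = m" "card B = m" "\<And>j. j < 3 \<Longrightarrow> card (S j) = m"
  shows "(\<Sum>a\<in>A. \<Sum>b\<in>B. \<Prod>j<3. card (S j - {a, b})) \<ge> m * ((m - 1) ^ 3 + (m - 1) * (m - 2) ^ 3)"
proof -
  obtain q where q: "m = q + 2" using m by (metis add.commute le_Suc_ex)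
  let ?f = "\<lambda>j a b. spare (S j) a b"
  have "(\<Sum>a\<in>A. \<Sum>b\<in>B. \<Prod>j<3. card (S j - {a, b})) = (\<Sum>a\<in>A. \<Sum>b\<in>B. \<Prod>j<3. q + ?f j a b)"
    using card_Diff_pair[of "S j" q for j] fin card q by (intro sum.cong prod.cong refl) auto
  also have "\<dots> \<ge> (q + 2) * ((q + 1) ^ 3 + (q + 1) * q ^ 3)"
  proof (cases "A = B")
    case True
    have "(\<Sum>b\<in>B. \<Prod>j<3. q + ?f j a b) \<ge> (q + 1) ^ 3 + (card B - 1) * q ^ 3" if a: "a \<in> A" for a
    proof (rule sum_ge_special[where s = a])
      have "(\<Prod>j<3::nat. q + 1) \<le> (\<Prod>j<3. q + ?f j a a)" using spare_diag by (intro prod_mono) auto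
      then show "(q + 1) ^ 3 \<le> (\<Prod>j<3. q + ?f j a a)" by simp
      fix b
      have "(\<Prod>j<3::nat. q) \<le> (\<Prod>j<3. q + ?f j a b)" by (intro prod_mono) auto
      then show "q ^ 3 \<le> (\<Prod>j<3. q + ?f j a b)" by simp
    qed (use True fin a in auto)
    then have "(\<Sum>a\<in>A. \<Sum>b\<in>B. \<Prod>j<3. q + ?f j a b) \<ge> card A * ((q + 1) ^ 3 + (card B - 1) * q ^ 3)"
      by (intro sum_ge_const) auto
    then show ?thesis using card q by simp
  next
    case ne: False
    let ?F = "\<lambda>j. \<Sum>a\<in>A. \<Sum>b\<in>B. ?f j a b"
    let ?FF = "\<lambda>i j. \<Sum>a\<in>A. \<Sum>b\<in>B. ?f i a b * ?f j a b"
    let ?FFF = "\<Sum>a\<in>A. \<Sum>b\<in>B. \<Prod>j<3. ?f j a b"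
    have "(\<Prod>j<3. q + ?f j a b) = q ^ 3 + q\<^sup>2 * ?f 0 a b + q\<^sup>2 * ?f 1 a b + q\<^sup>2 * ?f 2 a b
        + q * (?f 0 a b * ?f 1 a b) + q * (?f 0 a b * ?f 2 a b) + q * (?f 1 a b * ?f 2 a b)
        + (\<Prod>j<3. ?f j a b)" for a b
      by (simp add: eval_nat_numeral lessThan_Suc algebra_simps)
    then have expand: "(\<Sum>a\<in>A. \<Sum>b\<in>B. \<Prod>j<3. q + ?f j a b)
        = m * m * q ^ 3 + q\<^sup>2 * ?F 0 + q\<^sup>2 * ?F 1 + q\<^sup>2 * ?F 2
          + q * ?FF 0 1 + q * ?FF 0 2 + q * ?FF 1 2 + ?FFF"
      using card by (simp add: sum.distrib sum_distrib_left)
    have F: "?F j \<ge> 2 * m - 1" if "j < 3" for j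
      using sum_spare_ge[of A B "S j" m] fin card ne that by simp
    have "m * m * q ^ 3 + q\<^sup>2 * (2 * m - 1) + q\<^sup>2 * (2 * m - 1) + q\<^sup>2 * (2 * m - 1)
          + q * ?FF 0 1 + q * ?FF 0 2 + q * ?FF 1 2 + ?FFF \<le> (\<Sum>a\<in>A. \<Sum>b\<in>B. \<Prod>j<3. q + ?f j a b)"
      unfolding expand by (intro add_mono mult_left_mono F order_refl) auto
    moreover consider "q = 0" | "q = 1" | r where "q = r + 2"
      by (metis One_nat_def Suc_1 add_2_eq_Suc' not0_implies_Suc)
    then have "(q + 2) * ((q + 1) ^ 3 + (q + 1) * q ^ 3)
        \<le> m * m * q ^ 3 + q\<^sup>2 * (2 * m - 1) + q\<^sup>2 * (2 * m - 1) + q\<^sup>2 * (2 * m - 1)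
          + q * ?FF 0 1 + q * ?FF 0 2 + q * ?FF 1 2 + ?FFF"
    proof cases
      case 1
      then show ?thesis using sum_three_spares_ge[of A B S] fin card ne q by simp
    next
      case 2
      then have "?FF i j \<ge> 2" if "i < 3" "j < 3" for i j
        using sum_two_spares_ge[of A B "S i" "S j"] fin card q that by simp
      from this[of 0 1] this[of 0 2] this[of 1 2] show ?thesis using 2 q by (simp add: power3_eq_cube)
    next
      case 3
      have "(q + 2) * ((q + 1) ^ 3 + (q + 1) * q ^ 3)
        \<le> m * m * q ^ 3 + q\<^sup>2 * (2 * m - 1) + q\<^sup>2 * (2 * m - 1) + q\<^sup>2 * (2 * m - 1)"
      proof -
        have m': "2 * m - 1 = 2 * q + 3" using q by simp
        have "2 * 2 \<le> q * q" using 3 by (intro mult_mono) auto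
        then have "q * (2 * 2) \<le> q * (q * q)" by (rule mult_left_mono) simp
        moreover have "2 \<le> q" using 3 by simp
        \<comment> \<open>After expansion the two sides differ by
          \<open>3 * q^3 - (7 * q + 2)\<close>. At \<open>q = 1\<close> this is \<open>-6\<close>,
          which the three mixed sums of at least 2 just make up.\<close>
        ultimately have "7 * q + 2 \<le> 3 * (q * (q * q))" by linarith
        then show ?thesis
          unfolding m' unfolding q by (simp add: power3_eq_cube power2_eq_square algebra_simps)
      qed
      then show ?thesis by linarith
    qed
    ultimately show ?thesis by linarith
  qed
  finally show ?thesis by (simp add: q)
qed

lemma simple_graph_K23: "simple_graph {0..<5} (snd K23)"
  by (auto simp: simple_graph_def K23_def card_insert_if)

lemma num_L_colorings_K23:
  assumes "\<And>v. v < 5 \<Longrightarrow> finite (L v)"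
  shows "num_L_colorings {0..<5} (snd K23) L = (\<Sum>a\<in>L 0. \<Sum>b\<in>L 1. \<Prod>j<3. card (L (j + 2) - {a, b}))"
proof -
  have V: "{0..<5::nat} = {0, 1, 2, 3, 4}" by auto
  let ?R = "SIGMA (a, b):L 0 \<times> L 1. (L 2 - {a, b}) \<times> (L 3 - {a, b}) \<times> (L 4 - {a, b})"
  have proper: "proper_col (snd K23) f \<longleftrightarrow> (\<forall>i\<in>{0, 1}. \<forall>j\<in>{2, 3, 4}. f i \<noteq> f j)" for f :: "nat \<Rightarrow> nat"
    unfolding proper_col_iff[OF simple_graph_K23] by (auto simp: K23_def doubleton_eq_iff)
  have "bij_betw (\<lambda>f. ((f 0, f 1), f 2, f 3, f 4)) {f \<in> Pi\<^sub>E {0..<5} L. proper_col (snd K23) f} ?R"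
  proof (rule bij_betw_byWitness[where f' = "\<lambda>p. \<lambda>v\<in>{0..<5}.
        [fst (fst p), snd (fst p), fst (snd p), fst (snd (snd p)), snd (snd (snd p))] ! v"], goal_cases)
    case 1
    show ?case
    proof
      fix f assume "f \<in> {f \<in> Pi\<^sub>E {0..<5} L. proper_col (snd K23) f}"
      then have "f \<in> extensional {0..<5}" by (simp add: PiE_def)
      then have "(\<lambda>v\<in>{0..<5}. [f 0, f 1, f 2, f 3, f 4] ! v) = f"
        by (intro extensionalityI[of _ "{0..<5}"]) (auto simp: V)
      then show "(\<lambda>v\<in>{0..<5}. [fst (fst ((f 0, f 1), f 2, f 3, f 4)), snd (fst ((f 0, f 1), f 2, f 3, f 4)),
          fst (snd ((f 0, f 1), f 2, f 3, f 4)), fst (snd (snd ((f 0, f 1), f 2, f 3, f 4))),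
          snd (snd (snd ((f 0, f 1), f 2, f 3, f 4)))] ! v) = f" by simp
    qed
  next
    case 2
    then show ?case by auto
  next
    case 3
    show ?case
    proof (rule image_subsetI)
      fix f assume "f \<in> {f \<in> Pi\<^sub>E {0..<5} L. proper_col (snd K23) f}"
      then have f: "f \<in> Pi\<^sub>E {0..<5} L" "\<forall>i\<in>{0, 1}. \<forall>j\<in>{2, 3, 4}. f i \<noteq> f j"
        by (simp_all add: proper)
      have "f v \<in> L v" if "v < 5" for v by (rule PiE_mem[OF f(1)]) (simp add: that)
      from this[of 0] this[of 1] this[of 2] this[of 3] this[of 4] f(2)
      show "((f 0, f 1), f 2, f 3, f 4) \<in> ?R" by auto
    qed
  next
    case 4
    show ?case
    proof (rule image_subsetI)
      fix p assume pR: "p \<in> ?R"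
      obtain a b x y z where p: "p = ((a, b), x, y, z)" by (metis prod.collapse)
      have mem: "a \<in> L 0" "b \<in> L 1" "x \<in> L 2 - {a, b}" "y \<in> L 3 - {a, b}" "z \<in> L 4 - {a, b}"
        using pR unfolding p by auto
      have "\<forall>v\<in>{0..<5}. [a, b, x, y, z] ! v \<in> L v"
        unfolding V using mem by auto
      moreover have "\<forall>i\<in>{0, 1}. \<forall>j\<in>{2, 3, 4}. [a, b, x, y, z] ! i \<noteq> [a, b, x, y, z] ! j"
        using mem by auto
      ultimately show "(\<lambda>v\<in>{0..<5}. [fst (fst p), snd (fst p), fst (snd p), fst (snd (snd p)),
          snd (snd (snd p))] ! v) \<in> {f \<in> Pi\<^sub>E {0..<5} L. proper_col (snd K23) f}"
        unfolding p by (simp add: proper restrict_PiE_iff)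
    qed
  qed
  from bij_betw_same_card[OF this] have "num_L_colorings {0..<5} (snd K23) L = card ?R"
    by (simp add: num_L_colorings_def)
  also have "\<dots> = (\<Sum>(a, b)\<in>L 0 \<times> L 1. card ((L 2 - {a, b}) \<times> (L 3 - {a, b}) \<times> (L 4 - {a, b})))"
    using assms by (subst card_SigmaI) (auto simp: case_prod_beta)
  also have "\<dots> = (\<Sum>(a, b)\<in>L 0 \<times> L 1. \<Prod>j<3. card (L (j + 2) - {a, b}))"
    by (simp add: card_cartesian_product eval_nat_numeral lessThan_Suc algebra_simps)
  finally show ?thesis by (simp add: sum.cartesian_product)
qed

lemma count_minimal_K23:
  assumes m: "m \<ge> 2"
  shows "count_minimal K23 m"
  unfolding count_minimal_def
proof (intro allI impI)
  have V: "fst K23 = {0..<5}" by (simp add: K23_def)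
  fix L assume "m_assignment (fst K23) m L"
  then have L: "\<And>v. v < 5 \<Longrightarrow> finite (L v) \<and> card (L v) = m"
    by (simp add: V m_assignment_def)
  have "chrom_poly {0..<5} (snd K23) m = (\<Sum>a\<in>{1..m}. \<Sum>b\<in>{1..m}. card ({1..m} - {a, b}) ^ 3)"
    unfolding chrom_poly_def by (subst num_L_colorings_K23) auto
  also have "\<dots> = (\<Sum>a\<in>{1..m}. (m - 1) ^ 3 + (m - 1) * (m - 2) ^ 3)"
  proof (rule sum.cong)
    fix a assume a: "a \<in> {1..m}"
    have "(\<Sum>b\<in>{1..m} - {a}. card ({1..m} - {a, b}) ^ 3) = (\<Sum>b\<in>{1..m} - {a}. (m - 2) ^ 3)"
      using a by (intro sum.cong refl) (auto simp: card_Diff_subset numeral_2_eq_2)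
    then show "(\<Sum>b\<in>{1..m}. card ({1..m} - {a, b}) ^ 3) = (m - 1) ^ 3 + (m - 1) * (m - 2) ^ 3"
      using a by (simp add: sum.remove[of _ a])
  qed simp
  also have "\<dots> = m * ((m - 1) ^ 3 + (m - 1) * (m - 2) ^ 3)" by simp
  also have "\<dots> \<le> num_L_colorings {0..<5} (snd K23) L"
    using L m sum_prod_card_ge[of m "L 0" "L 1" "\<lambda>j. L (j + 2)"]
    by (subst num_L_colorings_K23) auto
  finally show "chrom_poly (fst K23) (snd K23) m \<le> num_L_colorings (fst K23) (snd K23) L"
    by (simp add: V)
qed

lemma count_minimal_K1: "count_minimal K1 m"
proof -
  have "num_L_colorings {0} {} L = card (L 0)" for L :: "nat \<Rightarrow> nat set"
    by (simp add: num_L_colorings_def proper_col_def card_PiE)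
  then show ?thesis
    by (auto simp: count_minimal_def K1_def chrom_poly_def m_assignment_def)
qed

section \<open>Rigid vertex sets\<close>

text \<open>Colourings of the subgraph induced on \<open>W\<close>, as total functions with
  arbitrary values elsewhere. Hence \<open>rigid\<close> compares two of them on \<open>W\<close>
  only.\<close>

definition list_colors :: "'a set set \<Rightarrow> 'a set \<Rightarrow> ('a \<Rightarrow> nat set) \<Rightarrow> ('a \<Rightarrow> nat) \<Rightarrow> bool" where
  "list_colors E W L f \<longleftrightarrow> (\<forall>v\<in>W. f v \<in> L v) \<and> (\<forall>u\<in>W. \<forall>v\<in>W. {u, v} \<in> E \<longrightarrow> f u \<noteq> f v)"

definition rigid :: "'a set set \<Rightarrow> 'a set \<Rightarrow> bool" where
  "rigid E W \<longleftrightarrow> (\<exists>L. (\<forall>v\<in>W. finite (L v) \<and> card (L v) = 2) \<and>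
     (\<forall>f g. list_colors E W L f \<longrightarrow> list_colors E W L g \<longrightarrow> (\<forall>v\<in>W. f v = g v)))"

lemma rigidI:
  assumes "\<And>v. v \<in> W \<Longrightarrow> finite (L v) \<and> card (L v) = 2"
    and "\<And>f g v. list_colors E W L f \<Longrightarrow> list_colors E W L g \<Longrightarrow> v \<in> W \<Longrightarrow> f v = g v"
  shows "rigid E W"
  unfolding rigid_def using assms by (intro exI[of _ L]) blast

lemma rigidE:
  assumes "rigid E W"
  obtains L where "\<forall>v\<in>W. finite (L v) \<and> card (L v) = 2"
    and "\<forall>f g. list_colors E W L f \<longrightarrow> list_colors E W L g \<longrightarrow> (\<forall>v\<in>W. f v = g v)"
  using assms unfolding rigid_def by (elim exE conjE) (rule that)

lemma list_colors_mono: "list_colors E W L f \<Longrightarrow> E' \<subseteq> E \<Longrightarrow> list_colors E' W L f"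
  unfolding list_colors_def by blast

text \<open>Additional edges only remove colourings. This carries rigid sets of a core over to the
  whole graph.\<close>

lemma rigid_mono:
  assumes "rigid E' W" "E' \<subseteq> E"
  shows "rigid E W"
proof -
  obtain L where L: "\<forall>v\<in>W. finite (L v) \<and> card (L v) = 2"
    and uniq: "\<forall>f g. list_colors E' W L f \<longrightarrow> list_colors E' W L g \<longrightarrow> (\<forall>v\<in>W. f v = g v)"
    by (rule rigidE[OF assms(1)])
  show ?thesis
    using L uniq list_colors_mono[OF _ assms(2)] by (intro rigidI[where L = L]) metis+
qed

text \<open>The colour of \<open>u\<close> is the same in all colourings, so the copied list of two
  colours leaves a single choice for \<open>v\<close>. Other edges from \<open>v\<close> into
  \<open>W\<close> can only exclude that choice.\<close>

lemma rigid_insert: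
  assumes "rigid E W" "u \<in> W" "{u, v} \<in> E" "v \<notin> W"
  shows "rigid E (insert v W)"
proof -
  obtain L where L: "\<forall>v\<in>W. finite (L v) \<and> card (L v) = 2"
    and uniq: "\<forall>f g. list_colors E W L f \<longrightarrow> list_colors E W L g \<longrightarrow> (\<forall>v\<in>W. f v = g v)"
    by (rule rigidE[OF assms(1)])
  let ?L = "L(v := L u)"
  have restr: "list_colors E W L f \<and> f v \<in> L u \<and> f v \<noteq> f u" if "list_colors E (insert v W) ?L f" for f
  proof (intro conjI)
    have mem: "f x \<in> ?L x" if "x \<in> insert v W" for x
      using \<open>list_colors E (insert v W) ?L f\<close> that unfolding list_colors_def by blast
    have proper: "f a \<noteq> f b" if "a \<in> insert v W" "b \<in> insert v W" "{a, b} \<in> E" for a b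
      using \<open>list_colors E (insert v W) ?L f\<close> that unfolding list_colors_def by blast
    have "f x \<in> L x" if "x \<in> W" for x
      using mem[of x] that assms(4) by (cases "x = v") auto
    then show "list_colors E W L f"
      unfolding list_colors_def using proper by blast
    show "f v \<in> L u" using mem[of v] by simp
    show "f v \<noteq> f u" using proper[of u v] assms(2,3) by auto
  qed
  show ?thesis
  proof (rule rigidI[where L = ?L])
    show "finite (?L x) \<and> card (?L x) = 2" if "x \<in> insert v W" for x
      using L that assms(2) by auto
  next
    fix f g x
    assume f: "list_colors E (insert v W) ?L f" and g: "list_colors E (insert v W) ?L g"
      and x: "x \<in> insert v W"
    have eq: "\<forall>y\<in>W. f y = g y" using uniq restr[OF f] restr[OF g] by blast
    obtain p q where "L u = {p, q}" using L assms(2) by (meson card_2_iff)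
    moreover have "f u \<in> L u" using restr[OF f] assms(2) by (simp add: list_colors_def)
    moreover have "f u = g u" using eq assms(2) by blast
    ultimately have "f v = g v" using restr[OF f] restr[OF g] by auto
    then show "f x = g x" using eq x by blast
  qed
qed

lemma crossing_edge:
  assumes "simple_graph V E" "connected_graph V E" "W \<subseteq> V" "W \<noteq> {}" "W \<noteq> V"
  obtains u v where "u \<in> W" "v \<in> V" "v \<notin> W" "{u, v} \<in> E"
proof -
  obtain a b where ab: "a \<in> W" "b \<in> V" "b \<notin> W" using assms by blast
  then have "(\<lambda>x y. {x, y} \<in> E)\<^sup>*\<^sup>* a b"
    using assms unfolding connected_graph_def by blast
  then have "b \<notin> W \<longrightarrow> (\<exists>u\<in>W. \<exists>v. v \<notin> W \<and> {u, v} \<in> E)"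
    by induction (use ab in auto)
  then obtain u v where "u \<in> W" "v \<notin> W" "{u, v} \<in> E" using ab by blast
  then show thesis using that edge_distinct(3)[OF assms(1)] by blast
qed

lemma rigid_extend:
  assumes "simple_graph V E" "connected_graph V E" "W \<subseteq> V" "W \<noteq> {}" "rigid E W"
  shows "rigid E V"
  using assms(3-5)
proof (induction "card (V - W)" arbitrary: W rule: less_induct)
  case less
  show ?case
  proof (cases "W = V")
    case False
    then obtain u v where uv: "u \<in> W" "v \<in> V" "v \<notin> W" "{u, v} \<in> E"
      using crossing_edge[OF assms(1,2) less.prems(1,2)] by blast
    have "finite V" using assms(1) by (simp add: simple_graph_def)
    then have "card (V - insert v W) < card (V - W)"
      using uv by (intro psubset_card_mono) auto
    then show ?thesis
      using less.hyps[of "insert v W"] rigid_insert[OF less.prems(3) uv(1,4,3)] less.prems(1) uv(2) by auto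
  qed (use less in simp)
qed

lemma num_L_colorings_rigid:
  assumes "simple_graph V E" "rigid E V"
  shows "\<exists>L. m_assignment V 2 L \<and> num_L_colorings V E L \<le> 1"
proof -
  obtain L where L: "\<forall>v\<in>V. finite (L v) \<and> card (L v) = 2"
    and uniq: "\<forall>f g. list_colors E V L f \<longrightarrow> list_colors E V L g \<longrightarrow> (\<forall>v\<in>V. f v = g v)"
    by (rule rigidE[OF assms(2)])
  have m: "m_assignment V 2 L" using L by (simp add: m_assignment_def)
  have lc: "list_colors E V L f" if "f \<in> {f \<in> Pi\<^sub>E V L. proper_col E f}" for f
    using that unfolding proper_col_iff[OF assms(1)] list_colors_def by (auto dest: PiE_mem)
  have eq: "f = g" if f: "f \<in> {f \<in> Pi\<^sub>E V L. proper_col E f}" and g: "g \<in> {f \<in> Pi\<^sub>E V L. proper_col E f}" for f g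
  proof (rule PiE_ext)
    show "f \<in> Pi\<^sub>E V L" "g \<in> Pi\<^sub>E V L" using f g by auto
    show "f v = g v" if "v \<in> V" for v using uniq lc[OF f] lc[OF g] that by blast
  qed
  have "finite {f \<in> Pi\<^sub>E V L. proper_col E f}"
    using finite_L_colorings[OF _ m] assms(1) by (simp add: simple_graph_def)
  then have "num_L_colorings V E L \<le> 1"
    unfolding num_L_colorings_def One_nat_def using eq by (subst card_le_Suc0_iff_eq) blast+
  then show ?thesis using m by blast
qed

section \<open>Two-colourings, and failure of minimality for two colours\<close>

text \<open>The \<open>LEAST\<close> in \<open>chromatic_number\<close> needs a witness:
  \<open>card V\<close> colours suffice, one for each vertex.\<close>

lemma chrom_poly_chromatic_number_pos:
  assumes "simple_graph V E"
  shows "chrom_poly V E (chromatic_number V E) > 0"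
  unfolding chromatic_number_def
proof (rule LeastI[of "\<lambda>k. chrom_poly V E k > 0"])
  have fin: "finite V" using assms by (simp add: simple_graph_def)
  then obtain h where h: "bij_betw h V {1..card V}" by (metis finite_same_card_bij card_atLeastAtMost diff_Suc_1 finite_atLeastAtMost)
  have "restrict h V \<in> Pi\<^sub>E V (\<lambda>_. {1..card V})"
    using bij_betwE[OF h] by auto
  moreover have "proper_col E (restrict h V)"
    unfolding proper_col_iff[OF assms]
  proof (intro allI impI)
    fix u v assume "{u, v} \<in> E"
    from edge_distinct[OF assms this] show "restrict h V u \<noteq> restrict h V v"
      using inj_on_eq_iff[OF bij_betw_imp_inj_on[OF h]] by simp
  qed
  ultimately have "{f \<in> Pi\<^sub>E V (\<lambda>_. {1..card V}). proper_col E f} \<noteq> {}" by blast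
  then show "chrom_poly V E (card V) > 0"
    unfolding chrom_poly_def num_L_colorings_def
    using finite_L_colorings[OF fin m_assignment_const] by (simp only: card_gt_0_iff) simp
qed

lemma two_coloring:
  assumes G: "simple_graph V E" and "chromatic_number V E = 2"
  obtains \<beta> where "\<beta> \<in> Pi\<^sub>E V (\<lambda>_. {1..2::nat})" "proper_col E \<beta>"
proof -
  have "chrom_poly V E 2 > 0" using chrom_poly_chromatic_number_pos[OF G] assms by simp
  then show thesis using that unfolding chrom_poly_def num_L_colorings_def
    by (auto simp: card_gt_0_iff)
qed

lemma chrom_poly_2_ge:
  assumes G: "simple_graph V E" and "chromatic_number V E = 2"
  shows "chrom_poly V E 2 \<ge> 2"
proof -
  let ?C = "{f \<in> Pi\<^sub>E V (\<lambda>_. {1..2::nat}). proper_col E f}"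
  obtain \<beta> where \<beta>: "\<beta> \<in> ?C" using two_coloring[OF assms] by blast
  \<comment> \<open>This exchanges the colours 1 and 2. The two values at a vertex have the odd sum
    3, so the colourings differ.\<close>
  define \<gamma> where "\<gamma> = restrict (\<lambda>v. 3 - \<beta> v) V"
  have val: "\<beta> v \<in> {1..2}" if "v \<in> V" for v using \<beta> that by (auto dest: PiE_mem)
  have "\<gamma> \<in> Pi\<^sub>E V (\<lambda>_. {1..2::nat})" using val by (fastforce simp: \<gamma>_def)
  moreover have "proper_col E \<gamma>"
    unfolding proper_col_iff[OF G]
  proof (intro allI impI)
    fix u v assume uv: "{u, v} \<in> E"
    then have "u \<in> V" "v \<in> V" "\<beta> u \<noteq> \<beta> v" using edge_distinct[OF G uv] \<beta> proper_col_iff[OF G] by auto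
    then show "\<gamma> u \<noteq> \<gamma> v" using val[of u] val[of v] by (auto simp: \<gamma>_def)
  qed
  moreover obtain v where "v \<in> V" using G by (auto simp: simple_graph_def)
  then have "\<gamma> v + \<beta> v = 3" using val[of v] by (auto simp: \<gamma>_def)
  then have "\<gamma> \<noteq> \<beta>" by (auto simp: mult_2[symmetric]) presburger
  then have "card {\<beta>, \<gamma>} = 2" by (simp add: eq_commute)
  ultimately have "{\<beta>, \<gamma>} \<subseteq> ?C" "card {\<beta>, \<gamma>} = 2" using \<beta> by auto
  moreover have "finite ?C"
    using finite_L_colorings[OF _ m_assignment_const] G by (auto simp: simple_graph_def)
  ultimately show ?thesis unfolding chrom_poly_def num_L_colorings_def by (metis card_mono)
qed

lemma not_count_minimal_if_rigid:
  assumes "simple_graph V E" "connected_graph V E" "chromatic_number V E = 2"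
    and "W \<subseteq> V" "W \<noteq> {}" "rigid E W"
  shows "\<not> count_minimal (V, E) 2"
proof -
  obtain L where "m_assignment V 2 L" "num_L_colorings V E L \<le> 1"
    using num_L_colorings_rigid[OF assms(1)] rigid_extend[OF assms(1,2,4-6)] by blast
  then show ?thesis
    using chrom_poly_2_ge[OF assms(1,3)] unfolding count_minimal_def by (auto intro!: exI[of _ L])
qed

section \<open>Lists that propagate colours along paths\<close>

abbreviation alternates :: "('a \<Rightarrow> 'b) \<Rightarrow> 'a list \<Rightarrow> bool" where
  "alternates f \<equiv> successively (\<lambda>u v. f u \<noteq> f v)"

lemma alternates_parity:
  assumes "alternates f ws" "ws \<noteq> []" "\<And>v. v \<in> set ws \<Longrightarrow> f v \<in> {p, q}"
  shows "f (hd ws) = f (last ws) \<longleftrightarrow> odd (length ws)"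
  using assms
proof (induction ws rule: induct_list012)
  case (3 x y zs)
  then have "f y = f (last (y # zs)) \<longleftrightarrow> odd (length (y # zs))" by auto
  moreover have "f x \<noteq> f y" using 3 by auto
  moreover have "f x \<in> {p, q}" "f y \<in> {p, q}" "f (last (y # zs)) \<in> {p, q}"
    using 3(5) last_in_set[of "y # zs"] by auto
  ultimately show ?case by auto
qed auto

text \<open>A row of dominoes: each list consists of the colour forced on the preceding vertex and
  one further colour, which is thereby forced in turn. \<open>chain_backward\<close> starts the row
  from the other end.\<close>

lemma chain_forward:
  assumes "alternates f (x # zs @ [y])" "\<And>i. i < length zs \<Longrightarrow> f (zs ! i) \<in> {F i, F (Suc i)}" "f x = F 0"
  shows "f y \<noteq> F (length zs) \<and> (\<forall>i<length zs. f (zs ! i) = F (Suc i))"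
  using assms
proof (induction zs arbitrary: x F)
  case (Cons z zs)
  have z: "f z = F 1" using Cons.prems(1,3) Cons.prems(2)[of 0] by auto
  have "f (zs ! i) \<in> {F (Suc i), F (Suc (Suc i))}" if "i < length zs" for i
    using Cons.prems(2)[of "Suc i"] that by simp
  then have "f y \<noteq> F (Suc (length zs)) \<and> (\<forall>i<length zs. f (zs ! i) = F (Suc (Suc i)))"
    using Cons.IH[of z "\<lambda>i. F (Suc i)"] Cons.prems(1) z by simp
  then show ?case using z by (simp add: nth_Cons split: nat.split)
qed auto

lemma chain_backward:
  assumes "alternates f (x # zs @ [y])" "\<And>i. i < length zs \<Longrightarrow> f (zs ! i) \<in> {F i, F (Suc i)}" "f y = F (length zs)"
  shows "f x \<noteq> F 0 \<and> (\<forall>i<length zs. f (zs ! i) = F i)"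
  using assms
proof (induction zs arbitrary: x F)
  case (Cons z zs)
  have "f (zs ! i) \<in> {F (Suc i), F (Suc (Suc i))}" if "i < length zs" for i
    using Cons.prems(2)[of "Suc i"] that by simp
  then have IH: "f z \<noteq> F 1 \<and> (\<forall>i<length zs. f (zs ! i) = F (Suc i))"
    using Cons.IH[of z "\<lambda>i. F (Suc i)"] Cons.prems(1,3) by simp
  then have "f z = F 0" using Cons.prems(2)[of 0] by auto
  then show ?case using IH Cons.prems(1) by (simp add: nth_Cons split: nat.split)
qed auto

lemma ex_color_walk:
  fixes p q :: nat
  assumes "n = 0 \<Longrightarrow> p = q" "n = 1 \<Longrightarrow> p \<noteq> q"
  shows "\<exists>F. F 0 = p \<and> F n = q \<and> (\<forall>i<n. F i \<noteq> F (Suc i))"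
  using assms
proof (induction n arbitrary: q)
  case (Suc n)
  show ?case
  proof (cases "n = 0")
    case True
    then show ?thesis using Suc.prems by (intro exI[of _ "\<lambda>i. if i = 0 then p else q"]) auto
  next
    case False
    \<comment> \<open>The colour \<open>p + q + 1\<close> differs from \<open>q\<close>, and from
      \<open>p\<close> as is required when \<open>n = 1\<close>.\<close>
    then obtain F where F: "F 0 = p" "F n = p + q + 1" "\<forall>i<n. F i \<noteq> F (Suc i)"
      using Suc.IH[of "p + q + 1"] by auto
    then have "\<forall>i<Suc n. (F(Suc n := q)) i \<noteq> (F(Suc n := q)) (Suc i)"
      by (auto simp: less_Suc_eq)
    then show ?thesis using F(1) by (intro exI[of _ "F(Suc n := q)"]) auto
  qed
qed auto

text \<open>The lists on the interior of a path exclude the end colours \<open>(p, q)\<close>, and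
  the interior is determined as soon as one end has its excluded colour. The last clause is needed
  in \<open>rigid_even_theta\<close>, where one pair of end colours survives. The end vertices
  \<open>x\<close> and \<open>y\<close> are left open and may coincide, as for the cycles in
  \<open>rigid_dumbbell\<close>.\<close>

definition kills :: "('a \<Rightarrow> nat set) \<Rightarrow> 'a list \<Rightarrow> nat \<Rightarrow> nat \<Rightarrow> bool" where
  "kills M zs p q \<longleftrightarrow> (\<forall>v\<in>set zs. finite (M v) \<and> card (M v) = 2) \<and>
     (\<forall>f x y. alternates f (x # zs @ [y]) \<longrightarrow> (\<forall>v\<in>set zs. f v \<in> M v) \<longrightarrow> f x = p \<longrightarrow> f y \<noteq> q) \<and>
     (\<forall>f g x y. alternates f (x # zs @ [y]) \<longrightarrow> alternates g (x # zs @ [y]) \<longrightarrow>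
        (\<forall>v\<in>set zs. f v \<in> M v \<and> g v \<in> M v) \<longrightarrow> f x = p \<and> g x = p \<or> f y = q \<and> g y = q \<longrightarrow>
        (\<forall>v\<in>set zs. f v = g v))"

lemma kills_chain:
  assumes "\<And>i. i < length zs \<Longrightarrow> M (zs ! i) = {F i, F (Suc i)}" "\<And>i. i < length zs \<Longrightarrow> F i \<noteq> F (Suc i)"
  shows "kills M zs (F 0) (F (length zs))"
  unfolding kills_def
proof (intro conjI allI impI)
  show "\<forall>v\<in>set zs. finite (M v) \<and> card (M v) = 2"
    using assms by (auto simp: in_set_conv_nth)
next
  fix f x y
  assume f: "alternates f (x # zs @ [y])" "\<forall>v\<in>set zs. f v \<in> M v" "f x = F 0"
  have "f (zs ! i) \<in> {F i, F (Suc i)}" if "i < length zs" for i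
    using f(2) nth_mem[OF that] unfolding assms(1)[OF that, symmetric] by blast
  then show "f y \<noteq> F (length zs)" using chain_forward[of f x zs y F] f(1,3) by blast
next
  fix f g x y
  assume f: "alternates f (x # zs @ [y])" and g: "alternates g (x # zs @ [y])"
    and M: "\<forall>v\<in>set zs. f v \<in> M v \<and> g v \<in> M v"
    and ends: "f x = F 0 \<and> g x = F 0 \<or> f y = F (length zs) \<and> g y = F (length zs)"
  have mem: "f (zs ! i) \<in> {F i, F (Suc i)}" "g (zs ! i) \<in> {F i, F (Suc i)}" if "i < length zs" for i
    using M nth_mem[OF that] unfolding assms(1)[OF that, symmetric] by blast+
  have "f (zs ! i) = g (zs ! i)" if "i < length zs" for i
    using ends
  proof
    assume "f x = F 0 \<and> g x = F 0"
    then show ?thesis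
      using chain_forward[of f x zs y F, OF f mem(1)] chain_forward[of g x zs y F, OF g mem(2)] that by simp
  next
    assume "f y = F (length zs) \<and> g y = F (length zs)"
    then show ?thesis
      using chain_backward[of f x zs y F, OF f mem(1)] chain_backward[of g x zs y F, OF g mem(2)] that by simp
  qed
  then show "\<forall>v\<in>set zs. f v = g v" by (auto simp: in_set_conv_nth)
qed

text \<open>The lists \<open>{F i, F (Suc i)}\<close> come from a walk \<open>F\<close> of colours
  from \<open>p\<close> to \<open>q\<close>. A single interior vertex has the list
  \<open>{p, q}\<close>, which requires \<open>p\<close> and \<open>q\<close> to differ.\<close>

lemma ex_kills:
  assumes "distinct zs" "length zs \<ge> 1" "length zs \<ge> 2 \<or> p \<noteq> q"
  shows "\<exists>M. kills M zs p q"
proof -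
  obtain F where F: "F 0 = p" "F (length zs) = q" "\<forall>i<length zs. F i \<noteq> F (Suc i)"
    using ex_color_walk[of "length zs" p q] assms(2,3) by fastforce
  \<comment> \<open>The lists are indexed by positions but needed as a function of vertices; as
    \<open>zs\<close> is distinct, each union has only one member.\<close>
  define M where "M v = (\<Union>i\<in>{i. i < length zs \<and> zs ! i = v}. {F i, F (Suc i)})" for v
  have "{j. j < length zs \<and> zs ! j = zs ! i} = {i}" if "i < length zs" for i
    using assms(1) that by (auto simp: nth_eq_iff_index_eq)
  then have "M (zs ! i) = {F i, F (Suc i)}" if "i < length zs" for i
    using that by (simp add: M_def)
  then show ?thesis using kills_chain[of zs M F] F by auto
qed

text \<open>If \<open>F\<close> alternates between \<open>p\<close> and \<open>q\<close>, all lists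
  are \<open>{p, q}\<close>. The same lists thus kill \<open>(p, q)\<close> and
  \<open>(q, p)\<close>, and \<open>rigid_even_theta\<close> uses both on one path.\<close>

lemma kills_alternating:
  assumes "odd (length zs)" "p \<noteq> q" "\<And>v. v \<in> set zs \<Longrightarrow> M v = {p, q}"
  shows "kills M zs p q"
proof -
  let ?F = "\<lambda>i::nat. if even i then p else q"
  have "kills M zs (?F 0) (?F (length zs))"
    using assms by (intro kills_chain) auto
  then show ?thesis using assms(1) by simp
qed

lemma kills_forbids:
  assumes "kills M zs p q" "alternates f (x # zs @ [y])" "\<And>v. v \<in> set zs \<Longrightarrow> f v \<in> M v" "f x = p"
  shows "f y \<noteq> q"
  using assms unfolding kills_def by blast

lemma kills_unique:
  assumes "kills M zs p q" "alternates f (x # zs @ [y])" "alternates g (x # zs @ [y])"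
    "\<And>v. v \<in> set zs \<Longrightarrow> f v \<in> M v" "\<And>v. v \<in> set zs \<Longrightarrow> g v \<in> M v"
    "f x = p \<and> g x = p \<or> f y = q \<and> g y = q" "v \<in> set zs"
  shows "f v = g v"
  using assms unfolding kills_def by blast

abbreviation walk :: "'a set set \<Rightarrow> 'a list \<Rightarrow> bool" where
  "walk E \<equiv> successively (\<lambda>u v. {u, v} \<in> E)"

lemma alternates_walk:
  assumes "list_colors E W L f" "walk E ws" "set ws \<subseteq> W"
  shows "alternates f ws"
  using assms(2)
proof (rule successively_mono)
  show "f u \<noteq> f v" if "u \<in> set ws" "v \<in> set ws" "{u, v} \<in> E" for u v
    using assms(1,3) that unfolding list_colors_def by blast
qed

lemma list_colors_mem: "list_colors E W L f \<Longrightarrow> v \<in> W \<Longrightarrow> f v \<in> L v"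
  by (simp add: list_colors_def)

lemma rigid_if_no_coloring:
  assumes "\<And>v. v \<in> W \<Longrightarrow> finite (L v) \<and> card (L v) = 2" and "\<And>f. \<not> list_colors E W L f"
  shows "rigid E W"
  by (rule rigidI[where L = L]) (use assms in auto)

section \<open>Rigid dumbbells, theta graphs and \<open>K24\<close>\<close>

text \<open>The first cycle excludes colour 1 at \<open>c\<close>, the lists \<open>{1, 2}\<close>
  carry colour 2 along \<open>as\<close> to a known colour at \<open>y\<close>, and the second cycle
  excludes that colour. For \<open>as = []\<close> the cycles share the vertex
  \<open>c\<close>.\<close>

lemma rigid_dumbbell:
  assumes dist: "distinct (c # cs @ as @ bs)" and y: "y = last (c # as)"
    and walks: "walk E (c # cs @ [c])" "walk E (c # as)" "walk E (y # bs @ [y])"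
    and len: "length cs \<ge> 2" "length bs \<ge> 2"
  shows "rigid E (set (c # cs @ as @ bs))"
proof -
  \<comment> \<open>The colour that alternation from colour 2 at \<open>c\<close> forces on
    \<open>y\<close>.\<close>
  define t :: nat where "t = (if even (length as) then 2 else 1)"
  obtain M N where M: "kills M cs 1 1" and N: "kills N bs t t"
    using ex_kills[of cs 1 1] ex_kills[of bs t t] dist len by auto
  let ?L = "\<lambda>v. if v \<in> set cs then M v else if v \<in> set bs then N v else {1, 2}"
  show ?thesis
  proof (rule rigid_if_no_coloring[where L = ?L])
    show "finite (?L v) \<and> card (?L v) = 2" for v
      using M N by (auto simp: kills_def)
  next
    fix f
    show "\<not> list_colors E (set (c # cs @ as @ bs)) ?L f"
    proof
      assume lc: "list_colors E (set (c # cs @ as @ bs)) ?L f"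
      note f = list_colors_mem[OF lc] and alt = alternates_walk[OF lc]
      have y_in: "y \<in> set (c # as)" unfolding y by (rule last_in_set) simp
      have two: "f v \<in> {1, 2}" if "v \<in> set (c # as)" for v
        using f[of v] dist that by (auto split: if_splits)
      have "alternates f (c # cs @ [c])" by (rule alt[OF walks(1)]) auto
      moreover have "f v \<in> M v" if "v \<in> set cs" for v using f[of v] that by auto
      ultimately have "f c \<noteq> 1" using kills_forbids[OF M, of f c c] by blast
      then have "f c = 2" using two[of c] by auto
      have "alternates f (c # as)" by (rule alt[OF walks(2)]) auto
      then have "f c = f y \<longleftrightarrow> odd (length (c # as))"
        using alternates_parity[of f "c # as" 1 2] two y by auto
      then have "f y = t" using \<open>f c = 2\<close> two[OF y_in] by (auto simp: t_def split: if_splits)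
      moreover have "alternates f (y # bs @ [y])" by (rule alt[OF walks(3)]) (use y_in in auto)
      moreover have "f v \<in> N v" if "v \<in> set bs" for v
        using f[of v] that dist by (auto split: if_splits)
      ultimately show False using kills_forbids[OF N, of f y y] by blast
    qed
  qed
qed

text \<open>Alternation of 1 and 2 along \<open>P\<close> makes the colours of \<open>x\<close> and
  \<open>y\<close> differ; \<open>Q\<close> excludes \<open>(1, 2)\<close> and \<open>R\<close>
  excludes \<open>(2, 1)\<close>. The path \<open>P\<close> may be a single edge.\<close>

lemma rigid_odd_theta:
  assumes dist: "distinct (x # y # P @ Q @ R)"
    and walks: "walk E (x # P @ [y])" "walk E (x # Q @ [y])" "walk E (x # R @ [y])"
    and len: "even (length P)" "length Q \<ge> 2" "length R \<ge> 2"
  shows "rigid E (set (x # y # P @ Q @ R))"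
proof -
  obtain M N where M: "kills M Q 1 2" and N: "kills N R 2 1"
    using ex_kills[of Q 1 2] ex_kills[of R 2 1] dist len by auto
  let ?L = "\<lambda>v. if v \<in> set Q then M v else if v \<in> set R then N v else {1, 2}"
  show ?thesis
  proof (rule rigid_if_no_coloring[where L = ?L])
    show "finite (?L v) \<and> card (?L v) = 2" for v
      using M N by (auto simp: kills_def)
  next
    fix f
    show "\<not> list_colors E (set (x # y # P @ Q @ R)) ?L f"
    proof
      assume lc: "list_colors E (set (x # y # P @ Q @ R)) ?L f"
      note f = list_colors_mem[OF lc]
      have two: "f v \<in> {1, 2}" if "v \<in> set (x # P @ [y])" for v
        using f[of v] dist that by (auto split: if_splits)
      have alt: "alternates f (x # P @ [y])" "alternates f (x # Q @ [y])" "alternates f (x # R @ [y])"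
        by (rule alternates_walk[OF lc walks(1)] alternates_walk[OF lc walks(2)]
            alternates_walk[OF lc walks(3)]; auto)+
      have "f x \<noteq> f y"
        using alternates_parity[OF alt(1) _ two] len(1) by simp
      moreover have "f v \<in> M v" if "v \<in> set Q" for v using f[of v] that by auto
      then have "f x = 1 \<longrightarrow> f y \<noteq> 2"
        using kills_forbids[OF M alt(2)] by blast
      moreover have "f v \<in> N v" if "v \<in> set R" for v
        using f[of v] that dist by (auto split: if_splits)
      then have "f x = 2 \<longrightarrow> f y \<noteq> 1"
        using kills_forbids[OF N alt(3)] by blast
      ultimately show False using two[of x] two[of y] by auto
    qed
  qed
qed

text \<open>The branch vertices get the lists \<open>{1, 2}\<close> and \<open>{1, 3}\<close>. The three paths forbid the pairs
  \<open>(1, 1)\<close>, \<open>(1, 3)\<close> and \<open>(2, 3)\<close>, and each of them is uniquely coloured when the pair is \<open>(2, 1)\<close>.\<close>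

lemma rigid_even_theta:
  assumes dist: "distinct (x # y # P @ Q @ R)"
    and walks: "walk E (x # P @ [y])" "walk E (x # Q @ [y])" "walk E (x # R @ [y])"
    and len: "odd (length Q)" "length P \<ge> 2" "length R \<ge> 1"
  shows "rigid E (set (x # y # P @ Q @ R))"
proof -
  obtain M N where M: "kills M P 1 1" and N: "kills N R 2 3"
    using ex_kills[of P 1 1] ex_kills[of R 2 3] dist len by auto
  let ?L = "\<lambda>v. if v \<in> set P then M v else if v \<in> set R then N v else if v = x then {1, 2} else {1, 3}"
  \<comment> \<open>The first form excludes the pair \<open>(1, 3)\<close>. The second is for
    uniqueness along \<open>Q\<close>, once \<open>y\<close> has colour 1.\<close>
  have Q: "kills (\<lambda>_. {1, 3}) Q 1 3" "kills (\<lambda>_. {1, 3}) Q 3 1"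
    by (rule kills_alternating[OF len(1)]; auto)+
  have fixed: "f x = 2 \<and> f y = 1 \<and> alternates f (x # P @ [y]) \<and> alternates f (x # Q @ [y]) \<and>
      alternates f (x # R @ [y]) \<and> (\<forall>v\<in>set P. f v \<in> M v) \<and> (\<forall>v\<in>set Q. f v \<in> {1, 3}) \<and> (\<forall>v\<in>set R. f v \<in> N v)"
    if lc: "list_colors E (set (x # y # P @ Q @ R)) ?L f" for f
  proof -
    note f = list_colors_mem[OF lc]
    have alt: "alternates f (x # P @ [y])" "alternates f (x # Q @ [y])" "alternates f (x # R @ [y])"
      by (rule alternates_walk[OF lc walks(1)] alternates_walk[OF lc walks(2)]
          alternates_walk[OF lc walks(3)]; auto)+
    have PQR: "\<And>v. v \<in> set P \<Longrightarrow> f v \<in> M v" "\<And>v. v \<in> set Q \<Longrightarrow> f v \<in> {1, 3}" "\<And>v. v \<in> set R \<Longrightarrow> f v \<in> N v"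
    proof -
      fix v
      show "f v \<in> M v" if "v \<in> set P" using f[of v] that by auto
      show "f v \<in> {1, 3}" if "v \<in> set Q" using f[of v] that dist by (auto split: if_splits)
      show "f v \<in> N v" if "v \<in> set R" using f[of v] that dist by (auto split: if_splits)
    qed
    have xy: "f x \<in> {1, 2}" "f y \<in> {1, 3}" using f[of x] f[of y] dist by (auto split: if_splits)
    moreover have "f x = 1 \<Longrightarrow> f y \<noteq> 1" by (rule kills_forbids[OF M alt(1) PQR(1)])
    moreover have "f x = 1 \<Longrightarrow> f y \<noteq> 3" by (rule kills_forbids[OF Q(1) alt(2) PQR(2)])
    moreover have "f x = 2 \<Longrightarrow> f y \<noteq> 3" by (rule kills_forbids[OF N alt(3) PQR(3)])
    ultimately have "f x = 2 \<and> f y = 1" by auto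
    then show ?thesis using alt PQR by blast
  qed
  show ?thesis
  proof (rule rigidI[where L = ?L])
    show "finite (?L v) \<and> card (?L v) = 2" for v
      using M N by (auto simp: kills_def)
  next
    fix f g v
    assume f: "list_colors E (set (x # y # P @ Q @ R)) ?L f" and g: "list_colors E (set (x # y # P @ Q @ R)) ?L g"
      and v: "v \<in> set (x # y # P @ Q @ R)"
    note F = fixed[OF f] and G = fixed[OF g]
    have "f v = g v" if "v \<in> set P" using kills_unique[OF M, of f x y g v] F G that by blast
    moreover have "f v = g v" if "v \<in> set Q" using kills_unique[OF Q(2), of f x y g v] F G that by blast
    moreover have "f v = g v" if "v \<in> set R" using kills_unique[OF N, of f x y g v] F G that by blast
    ultimately show "f v = g v" using v F G by auto
  qed
qed

text \<open>Each of the four choices of colours for \<open>u\<close> and \<open>w\<close> is the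
  whole list of one of the other vertices.\<close>

lemma rigid_K24:
  assumes dist: "distinct [u, w, y1, y2, y3, y4]"
    and adj: "\<And>y. y \<in> {y1, y2, y3, y4} \<Longrightarrow> {u, y} \<in> E \<and> {w, y} \<in> E"
  shows "rigid E {u, w, y1, y2, y3, y4}"
proof (rule rigid_if_no_coloring)
  let ?L = "(\<lambda>_. {1, 2::nat})(w := {3, 4}, y1 := {1, 3}, y2 := {1, 4}, y3 := {2, 3}, y4 := {2, 4})"
  show "finite (?L v) \<and> card (?L v) = 2" for v by auto
  fix f
  show "\<not> list_colors E {u, w, y1, y2, y3, y4} ?L f"
  proof
    assume lc: "list_colors E {u, w, y1, y2, y3, y4} ?L f"
    note f = list_colors_mem[OF lc]
    have "f u \<noteq> f y \<and> f w \<noteq> f y" if "y \<in> {y1, y2, y3, y4}" for y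
      using lc adj[OF that] that unfolding list_colors_def by blast
    from this[of y1] this[of y2] this[of y3] this[of y4]
    show False
      using f[of u] f[of w] f[of y1] f[of y2] f[of y3] f[of y4] dist by auto
  qed
qed

section \<open>Connected bipartite graphs of minimum degree two\<close>

text \<open>What a core with more than one vertex inherits if the whole graph is
  \<open>count_minimal\<close> for \<open>m = 2\<close>. The map \<open>\<beta>\<close> comes from a
  two-colouring of the whole graph and controls the parity of walks.\<close>

locale flexible_bipartite_graph =
  fixes V :: "'a set" and E :: "'a set set" and \<beta> :: "'a \<Rightarrow> nat"
  assumes simple: "simple_graph V E" and conn: "connected_graph V E"
    and deg: "\<And>v. v \<in> V \<Longrightarrow> degree V E v \<ge> 2"
    and \<beta>_range: "\<And>v. v \<in> V \<Longrightarrow> \<beta> v \<in> {1, 2}" and \<beta>_proper: "\<And>u v. {u, v} \<in> E \<Longrightarrow> \<beta> u \<noteq> \<beta> v"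
    and not_rigid: "\<And>W. W \<subseteq> V \<Longrightarrow> W \<noteq> {} \<Longrightarrow> \<not> rigid E W"
begin

lemma other_neighbour:
  assumes "v \<in> V" obtains w where "{v, w} \<in> E" "w \<in> V" "w \<noteq> p"
proof -
  have "\<not> {u \<in> V. {u, v} \<in> E} \<subseteq> {p}"
    using deg[OF assms] card_mono[of "{p}" "{u \<in> V. {u, v} \<in> E}"] by (auto simp: degree_def)
  then show thesis using that by (auto simp: insert_commute)
qed

lemma walk_rev: "walk E (rev ws) \<longleftrightarrow> walk E ws"
  by (simp add: insert_commute)

lemma walk_parity:
  assumes "walk E ws" "ws \<noteq> []" "set ws \<subseteq> V"
  shows "\<beta> (hd ws) = \<beta> (last ws) \<longleftrightarrow> odd (length ws)"
proof (rule alternates_parity[where p = 1 and q = 2])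
  show "alternates \<beta> ws" using assms(1) by (rule successively_mono) (use \<beta>_proper in auto)
qed (use assms \<beta>_range in auto)

text \<open>By \<open>\<beta>\<close> the three lengths have the same parity, and a rigid theta
  graph applies after permuting the paths. The path \<open>P\<close> may be empty, and then the
  conclusion is absurd: this excludes chords and ears across an edge.\<close>

lemma theta_lengths:
  assumes dist: "distinct (x # y # P @ Q @ R)" and sub: "set (x # y # P @ Q @ R) \<subseteq> V"
    and walks: "walk E (x # P @ [y])" "walk E (x # Q @ [y])" "walk E (x # R @ [y])"
    and ne: "Q \<noteq> []" "R \<noteq> []"
  shows "length P = 1 \<and> length Q = 1 \<and> length R = 1"
proof (rule ccontr)
  assume contr: "\<not> ?thesis"
  have par: "even (length P) \<longleftrightarrow> even (length Q)" "even (length P) \<longleftrightarrow> even (length R)"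
    using walk_parity[OF walks(1)] walk_parity[OF walks(2)] walk_parity[OF walks(3)] sub by auto
  have rig: "\<not> rigid E (set (x # y # P @ Q @ R))" using sub by (intro not_rigid) auto
  show False
  proof (cases "even (length P)")
    case True
    then have "even (length Q)" "even (length R)" using par by auto
    then have "length Q \<noteq> 1" "length R \<noteq> 1" by (metis odd_one)+
    moreover have "length Q \<noteq> 0" "length R \<noteq> 0" using ne by auto
    ultimately have "length Q \<ge> 2" "length R \<ge> 2" by linarith+
    then show False using rigid_odd_theta[OF dist walks True] rig by blast
  next
    case False
    then have odd: "odd (length P)" "odd (length Q)" "odd (length R)" using par by auto
    then have pos: "length P \<ge> 1" "length Q \<ge> 1" "length R \<ge> 1"
      by (auto simp: Suc_le_eq dest: odd_pos)
    consider "length P \<ge> 2" | "length Q \<ge> 2" | "length R \<ge> 2"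
      using contr pos by linarith
    then show False
    proof cases
      case 1
      then show False using rigid_even_theta[OF dist walks odd(2)] pos rig by blast
    next
      case 2
      have "distinct (x # y # Q @ P @ R)" using dist by auto
      moreover have "set (x # y # Q @ P @ R) = set (x # y # P @ Q @ R)" by auto
      ultimately show False
        using rigid_even_theta[of x y Q P R E] walks odd(1) 2 pos(3) rig by simp
    next
      case 3
      have "distinct (x # y # R @ Q @ P)" using dist by auto
      moreover have "set (x # y # R @ Q @ P) = set (x # y # P @ Q @ R)" by auto
      ultimately show False
        using rigid_even_theta[of x y R Q P E] walks odd(2) 3 pos(1) rig by simp
    qed
  qed
qed

lemma no_dumbbell:
  assumes "distinct (c # cs @ as @ bs)" "set (c # cs @ as @ bs) \<subseteq> V"
    "walk E (c # cs @ [c])" "walk E (c # as)" "walk E (last (c # as) # bs @ [last (c # as)])"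
    "length cs \<ge> 2" "length bs \<ge> 2"
  shows False
  using rigid_dumbbell[OF assms(1) refl assms(3-7)] not_rigid[OF assms(2)] by simp

section \<open>Maximal paths outside a vertex set, ears and lollipops\<close>

text \<open>The last vertex of a longest path leaving \<open>S\<close> has a second neighbour, which
  by maximality lies in \<open>S\<close> or on the path. The excluded vertex
  \<open>last (c # butlast zs)\<close> is its predecessor.\<close>

lemma maximal_path_outside:
  assumes S: "S \<subseteq> V" "S \<noteq> {}" "S \<noteq> V"
  obtains c zs w where "c \<in> S" "zs \<noteq> []" "distinct zs" "set zs \<subseteq> V - S" "walk E (c # zs)"
    "w \<in> S \<union> set zs" "{last zs, w} \<in> E" "w \<noteq> last (c # butlast zs)"
proof -
  let ?P = "\<lambda>zs. zs \<noteq> [] \<and> distinct zs \<and> set zs \<subseteq> V - S \<and> (\<exists>c\<in>S. walk E (c # zs))"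
  have fin: "finite V" using simple by (simp add: simple_graph_def)
  obtain u v where "u \<in> S" "v \<in> V" "v \<notin> S" "{u, v} \<in> E"
    using crossing_edge[OF simple conn S] by blast
  then have start: "?P [v]" by auto
  have bound: "\<forall>zs. ?P zs \<longrightarrow> length zs < Suc (card V)"
  proof (intro allI impI)
    fix zs assume "?P zs"
    then have "length zs = card (set zs)" "set zs \<subseteq> V" by (auto simp: distinct_card)
    then show "length zs < Suc (card V)" using card_mono[OF fin] by (metis le_imp_less_Suc)
  qed
  obtain zs where zs: "?P zs" and max: "\<forall>zs'. ?P zs' \<longrightarrow> length zs' \<le> length zs"
    using ex_has_greatest_nat[of ?P, OF start bound] by (elim exE conjE) (rule that; blast)
  then obtain c where c: "c \<in> S" "walk E (c # zs)" by blast
  have "last zs \<in> V" using zs last_in_set[of zs] by blast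
  then obtain w where w: "{last zs, w} \<in> E" "w \<in> V" "w \<noteq> last (c # butlast zs)"
    by (rule other_neighbour)
  have "w \<in> S \<union> set zs"
  proof (rule ccontr)
    assume nw: "w \<notin> S \<union> set zs"
    have "walk E (c # zs @ [w])"
      using c(2) w(1) zs by (simp add: successively_append_iff successively_Cons)
    then have "?P (zs @ [w])" using zs nw w(2) c(1) by auto
    then have "length (zs @ [w]) \<le> length zs" using max by blast
    then show False by simp
  qed
  then show thesis using that zs c w by blast
qed

definition ear :: "'a set \<Rightarrow> 'a \<Rightarrow> 'a list \<Rightarrow> 'a \<Rightarrow> bool" where
  "ear S c zs w \<longleftrightarrow> zs \<noteq> [] \<and> distinct zs \<and> set zs \<subseteq> V - S \<and> walk E (c # zs @ [w])"

text \<open>The stick \<open>as\<close> leads from \<open>c\<close> to a vertex at which the cycle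
  through \<open>bs\<close> closes. For \<open>as = []\<close> this vertex is \<open>c\<close>
  itself.\<close>

definition lollipop :: "'a set \<Rightarrow> 'a \<Rightarrow> 'a list \<Rightarrow> 'a list \<Rightarrow> bool" where
  "lollipop S c as bs \<longleftrightarrow> distinct (as @ bs) \<and> set (as @ bs) \<subseteq> V - S \<and> walk E (c # as) \<and>
     walk E (last (c # as) # bs @ [last (c # as)]) \<and> length bs \<ge> 2"

lemma ear_rev:
  assumes "ear S c zs w" shows "ear S w (rev zs) c"
proof -
  have "walk E (rev (c # zs @ [w]))" using assms unfolding ear_def walk_rev by blast
  then show ?thesis using assms by (auto simp: ear_def)
qed

text \<open>The second neighbour \<open>w\<close> closes a cycle if it lies on the path or equals
  \<open>c\<close>, and completes an ear otherwise. As \<open>w\<close> is not the predecessor, the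
  cycle has at least three vertices.\<close>

lemma lollipop_or_ear:
  assumes "S \<subseteq> V" "S \<noteq> {}" "S \<noteq> V"
  shows "(\<exists>c\<in>S. \<exists>as bs. lollipop S c as bs) \<or> (\<exists>c\<in>S. \<exists>w\<in>S. \<exists>zs. c \<noteq> w \<and> ear S c zs w)"
proof -
  obtain c zs w where c: "c \<in> S" and zs: "zs \<noteq> []" "distinct zs" "set zs \<subseteq> V - S" "walk E (c # zs)"
    and w: "w \<in> S \<union> set zs" "{last zs, w} \<in> E" "w \<noteq> last (c # butlast zs)"
    by (rule maximal_path_outside[OF assms])
  consider "w \<in> set zs" | "w = c" | "w \<in> S" "w \<noteq> c" using w(1) by blast
  then show ?thesis
  proof cases
    case 1
    then obtain as bs where split: "zs = as @ w # bs" by (metis split_list)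
    have "last zs \<noteq> w" using edge_distinct(1)[OF simple w(2)] .
    then have "bs \<noteq> []" using split by auto
    moreover have "bs \<noteq> [b]" for b
      using w(3) split by (auto simp: butlast_append)
    ultimately have "length bs \<ge> 2"
      by (cases bs; cases "tl bs") auto
    moreover have "walk E (w # bs @ [w])" "walk E (c # as @ [w])"
      using zs(4) w(2) \<open>bs \<noteq> []\<close> unfolding split
      by (auto simp: successively_append_iff successively_Cons hd_append)
    ultimately have "lollipop S c (as @ [w]) bs"
      using zs split by (auto simp: lollipop_def)
    then show ?thesis using c by blast
  next
    case 2
    have "zs \<noteq> [z]" for z using w(3) 2 by auto
    then have "length zs \<ge> 2" using zs(1) by (cases zs; cases "tl zs") auto
    moreover have "walk E (c # zs @ [c])"
      using zs(1,4) w(2) 2 by (simp add: successively_append_iff successively_Cons)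
    ultimately have "lollipop S c [] zs" using zs by (simp add: lollipop_def)
    then show ?thesis using c by blast
  next
    case 3
    have "walk E (c # zs @ [w])"
      using zs(1,4) w(2) by (simp add: successively_append_iff successively_Cons)
    then have "ear S c zs w" using zs by (simp add: ear_def)
    moreover have "c \<noteq> w" using 3 by simp
    ultimately show ?thesis using 3 c by blast
  qed
qed

section \<open>Cycles, their chords and their attachments\<close>

definition cycle :: "'a list \<Rightarrow> bool" where
  "cycle vs \<longleftrightarrow> distinct vs \<and> length vs \<ge> 3 \<and> set vs \<subseteq> V \<and> walk E (vs @ [hd vs])"

text \<open>Outside a single vertex there is no ear with two different ends, so a lollipop remains,
  and it contains a cycle.\<close>

lemma ex_cycle: "\<exists>vs. cycle vs"
proof -
  obtain v where v: "v \<in> V" using simple by (auto simp: simple_graph_def)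
  then obtain w where "{v, w} \<in> E" "w \<in> V" by (rule other_neighbour)
  then have "{v} \<noteq> V" using edge_distinct(1)[OF simple] by blast
  then obtain as bs where lp: "lollipop {v} v as bs"
    using lollipop_or_ear[of "{v}"] v by auto
  let ?y = "last (v # as)"
  have y: "?y \<in> set (v # as)" by (rule last_in_set) simp
  have "v \<notin> set bs" "set as \<inter> set bs = {}" "distinct bs" "set bs \<subseteq> V" "set as \<subseteq> V"
    using lp unfolding lollipop_def by auto
  then have "?y \<notin> set bs" "?y \<in> V" using y v by auto
  then have "cycle (?y # bs)"
    using lp \<open>distinct bs\<close> \<open>set bs \<subseteq> V\<close> by (auto simp: cycle_def lollipop_def)
  then show ?thesis by blast
qed

lemma cycle_rotate:
  assumes "cycle (A @ a # D)"
  shows "walk E (a # D @ A @ [a])"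
proof (cases A)
  case (Cons a0 A')
  then show ?thesis
    using assms by (auto simp: cycle_def successively_append_iff successively_Cons hd_append split: if_splits)
qed (use assms in \<open>simp add: cycle_def\<close>)

lemma cycle_two_paths:
  assumes "cycle (A @ a # B @ b # D)"
  shows "walk E (a # B @ [b])" "walk E (a # rev (D @ A) @ [b])"
proof -
  have w: "walk E ((a # B @ [b]) @ D @ A @ [a])" "walk E ((a # B) @ b # D @ A @ [a])"
    using cycle_rotate[OF assms] by simp_all
  show "walk E (a # B @ [b])" using w(1) unfolding successively_append_iff by blast
  have "walk E (b # D @ A @ [a])" using w(2) unfolding successively_append_iff by blast
  then have "walk E (rev (b # D @ A @ [a]))" unfolding walk_rev .
  then show "walk E (a # rev (D @ A) @ [b])" by simp
qed

text \<open>A chord and the two arcs between its ends form a theta graph with an empty first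
  path.\<close>

lemma cycle_no_chord:
  assumes cyc: "cycle (A @ a # B @ b # D)" and adj: "{a, b} \<in> E"
  shows "B = [] \<or> D @ A = []"
proof (rule ccontr)
  assume "\<not> ?thesis"
  then have ne: "B \<noteq> []" "rev (D @ A) \<noteq> []" by auto
  have "distinct (a # b # [] @ B @ rev (D @ A))" "set (a # b # [] @ B @ rev (D @ A)) \<subseteq> V"
    using cyc by (auto simp: cycle_def)
  moreover have "walk E (a # [] @ [b])" using adj by simp
  ultimately have "length ([] :: 'a list) = 1"
    using theta_lengths[OF _ _ _ cycle_two_paths[OF cyc] ne] by blast
  then show False by simp
qed

lemma cycle_no_lollipop:
  assumes cyc: "cycle vs" and c: "c \<in> set vs" and lp: "lollipop (set vs) c as bs"
  shows False
proof -
  obtain A D where vs: "vs = A @ c # D" using c by (metis split_list)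
  show False
  proof (rule no_dumbbell[of c "D @ A" as bs])
    show "walk E (c # (D @ A) @ [c])" using cycle_rotate[of A c D] cyc vs by simp
    show "distinct (c # (D @ A) @ as @ bs)" "set (c # (D @ A) @ as @ bs) \<subseteq> V" "length (D @ A) \<ge> 2"
      using cyc lp unfolding cycle_def lollipop_def vs by auto
  qed (use lp in \<open>auto simp: lollipop_def\<close>)
qed

lemma split_two:
  assumes "x \<in> set vs" "y \<in> set vs" "x \<noteq> y"
  obtains A B D where "vs = A @ x # B @ y # D" | A B D where "vs = A @ y # B @ x # D"
proof -
  obtain A D where vs: "vs = A @ x # D" using assms(1) by (metis split_list)
  consider "y \<in> set D" | "y \<in> set A" using assms vs by auto
  then show thesis
  proof cases
    case 1
    then obtain B D' where "D = B @ y # D'" using split_list by fast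
    then show thesis using that(1) vs by simp
  next
    case 2
    then obtain A1 A2 where "A = A1 @ y # A2" using split_list by fast
    then show thesis using that(2) vs by simp
  qed
qed

section \<open>Copies of \<open>K23\<close> and their attachments\<close>

text \<open>Only the presence of edges is demanded; that there are no others follows later from
  \<open>\<beta>\<close>.\<close>

definition K23_in :: "'a \<Rightarrow> 'a \<Rightarrow> 'a \<Rightarrow> 'a \<Rightarrow> 'a \<Rightarrow> bool" where
  "K23_in u w x y z \<longleftrightarrow> distinct [u, w, x, y, z] \<and> {u, w, x, y, z} \<subseteq> V \<and>
     (\<forall>a\<in>{u, w}. \<forall>b\<in>{x, y, z}. {a, b} \<in> E)"

lemma cycle_ear_K23:
  assumes cyc: "cycle vs" and c: "c \<in> set vs" "w \<in> set vs" "c \<noteq> w" and ear: "ear (set vs) c zs w"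
  shows "\<exists>u w x y z. K23_in u w x y z"
proof -
  have main: "\<exists>u w x y z. K23_in u w x y z"
    if vs: "vs = A @ a # B @ b # D" and er: "ear (set vs) a zs b" for A a B b D zs
  proof -
    have cyc': "cycle (A @ a # B @ b # D)" using cyc vs by simp
    note paths = cycle_two_paths[OF cyc']
    have len: "length B + length (D @ A) \<ge> 1" using cyc' by (simp add: cycle_def)
    have dist: "distinct (a # b # B @ rev (D @ A) @ zs)" "set (a # b # B @ rev (D @ A) @ zs) \<subseteq> V"
      using cyc' er unfolding ear_def cycle_def vs by auto
    have ez: "walk E (a # zs @ [b])" "zs \<noteq> []" using er by (auto simp: ear_def)
    have "length B = 1 \<and> length (rev (D @ A)) = 1 \<and> length zs = 1"
    \<comment> \<open>In \<open>theta_lengths\<close> only the first path may be empty, so an arc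
      that is a single edge has to take that place.\<close>
    proof (cases "rev (D @ A) = []")
      case False
      then show ?thesis using theta_lengths[OF dist paths ez(1) _ ez(2)] by blast
    next
      case True
      have d: "distinct (a # b # rev (D @ A) @ B @ zs)" "set (a # b # rev (D @ A) @ B @ zs) \<subseteq> V"
        using dist by auto
      have "B \<noteq> []" using True len by auto
      then show ?thesis using theta_lengths[OF d paths(2,1) ez(1) _ ez(2)] by blast
    qed
    then have "length B = 1" "length (D @ A) = 1" "length zs = 1" by simp_all
    then obtain p q r where pqr: "B = [p]" "D @ A = [q]" "zs = [r]"
      by (metis length_0_conv length_Suc_conv One_nat_def)
    have "walk E (a # [p] @ [b])" "walk E (a # rev [q] @ [b])" "walk E (a # [r] @ [b])"
      using paths ez pqr by auto
    then have "K23_in a b p q r"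
      using dist unfolding pqr by (auto simp: K23_in_def insert_commute)
    then show ?thesis by blast
  qed
  show ?thesis
    by (rule split_two[OF c]) (use main ear ear_rev[OF ear] in blast)+
qed

text \<open>The ear has a single interior vertex, which becomes the fourth common neighbour of
  \<open>u\<close> and \<open>w\<close>.\<close>

lemma K23_ear_branch:
  assumes K: "K23_in u w x y z" and ear: "ear {u, w, x, y, z} u zs w"
  shows False
proof -
  have "distinct (u # w # [x] @ [y] @ zs)" "set (u # w # [x] @ [y] @ zs) \<subseteq> V"
    using K ear by (auto simp: K23_in_def ear_def)
  moreover have "walk E (u # [x] @ [w])" "walk E (u # [y] @ [w])" "walk E (u # zs @ [w])" "zs \<noteq> []"
    using K ear by (auto simp: K23_in_def ear_def insert_commute)
  ultimately have "length zs = 1" using theta_lengths[of u w "[x]" "[y]" zs] by simp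
  then obtain t where t: "zs = [t]" by (metis length_0_conv length_Suc_conv One_nat_def)
  have "rigid E {u, w, x, y, z, t}"
    by (rule rigid_K24) (use K ear t in \<open>auto simp: K23_in_def ear_def insert_commute\<close>)
  moreover have "{u, w, x, y, z, t} \<subseteq> V" using K ear t by (auto simp: K23_in_def ear_def)
  ultimately show False using not_rigid by blast
qed

text \<open>The edge \<open>{u, x}\<close>, the path through \<open>y\<close> and \<open>w\<close>,
  and the ear form a theta graph with an empty first path.\<close>

lemma K23_ear_edge:
  assumes K: "K23_in u w x y z" and ear: "ear {u, w, x, y, z} u zs x"
  shows False
proof -
  have "distinct (u # x # [] @ [y, w] @ zs)" "set (u # x # [] @ [y, w] @ zs) \<subseteq> V"
    using K ear by (auto simp: K23_in_def ear_def)
  moreover have "walk E (u # [] @ [x])" "walk E (u # [y, w] @ [x])" "walk E (u # zs @ [x])" "zs \<noteq> []"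
    using K ear by (auto simp: K23_in_def ear_def insert_commute)
  ultimately show False using theta_lengths[of u x "[]" "[y, w]" zs] by simp
qed

text \<open>The ear has a single interior vertex \<open>t\<close>. Then the edge between
  \<open>u\<close> and \<open>x\<close> is joined by the paths through \<open>y, t\<close> and
  through \<open>z, w\<close> to a theta graph with an empty first path.\<close>

lemma K23_ear_middle:
  assumes K: "K23_in u w x y z" and ear: "ear {u, w, x, y, z} x zs y"
  shows False
proof -
  have "distinct (x # y # [u] @ [w] @ zs)" "set (x # y # [u] @ [w] @ zs) \<subseteq> V"
    using K ear by (auto simp: K23_in_def ear_def)
  moreover have "walk E (x # [u] @ [y])" "walk E (x # [w] @ [y])" "walk E (x # zs @ [y])" "zs \<noteq> []"
    using K ear by (auto simp: K23_in_def ear_def insert_commute)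
  ultimately have "length zs = 1" using theta_lengths[of x y "[u]" "[w]" zs] by simp
  then obtain t where t: "zs = [t]" by (metis length_0_conv length_Suc_conv One_nat_def)
  have "distinct (u # x # [] @ [y, t] @ [z, w])" "set (u # x # [] @ [y, t] @ [z, w]) \<subseteq> V"
    using K ear t by (auto simp: K23_in_def ear_def)
  moreover have "walk E (u # [] @ [x])" "walk E (u # [y, t] @ [x])" "walk E (u # [z, w] @ [x])"
    using K ear t by (auto simp: K23_in_def ear_def insert_commute)
  ultimately show False using theta_lengths[of u x "[]" "[y, t]" "[z, w]"] by simp
qed

text \<open>By the symmetries of \<open>K23\<close> and reversal of ears, the three preceding
  configurations cover all pairs of ends.\<close>

lemma K23_no_ear:
  assumes K: "K23_in u w x y z" and S: "c \<in> {u, w, x, y, z}" "d \<in> {u, w, x, y, z}" "c \<noteq> d"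
    and ear: "ear {u, w, x, y, z} c zs d"
  shows False
proof -
  let ?S = "{u, w, x, y, z}"
  have branch: False if "ear ?S a zs b" "a \<in> {u, w}" "b \<in> {u, w}" "a \<noteq> b" for a b zs
    using that K23_ear_branch[OF K] ear_rev[of ?S w zs u] by auto
  have edge': False if "K23_in a b p q r" "ear ?S a zs p" "{a, b, p, q, r} = ?S" for a b p q r zs
    using that K23_ear_edge[of a b p q r zs] by simp
  have Ks: "K23_in a b x y z \<and> K23_in a b y x z \<and> K23_in a b z x y \<and> {a, b} = {u, w}"
    if "a = u \<and> b = w \<or> a = w \<and> b = u" for a b
    using that K by (auto simp: K23_in_def)
  have edge: False if er: "ear ?S a zs p" and a: "a \<in> {u, w}" and p: "p \<in> {x, y, z}" for a p zs
  proof -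
    obtain b where ab: "a = u \<and> b = w \<or> a = w \<and> b = u" using a by blast
    have S: "{a, b, x, y, z} = ?S" "{a, b, y, x, z} = ?S" "{a, b, z, x, y} = ?S" using ab by auto
    consider "p = x" | "p = y" | "p = z" using p by blast
    then show False
    proof cases
      case 1
      then show False using edge'[OF _ _ S(1)] Ks[OF ab] er by blast
    next
      case 2
      then show False using edge'[OF _ _ S(2)] Ks[OF ab] er by blast
    next
      case 3
      then show False using edge'[OF _ _ S(3)] Ks[OF ab] er by blast
    qed
  qed
  have middle': False if "K23_in u w p q r" "ear ?S p zs q" "{u, w, p, q, r} = ?S" for p q r zs
    using that K23_ear_middle[of u w p q r zs] by simp
  have middle: False if er: "ear ?S p zs q" and pq: "p \<in> {x, y, z}" "q \<in> {x, y, z}" "p \<noteq> q" for p q zs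
  proof -
    have "\<exists>r\<in>{x, y, z}. {p, q, r} = {x, y, z} \<and> r \<noteq> p \<and> r \<noteq> q"
      using pq K unfolding K23_in_def by auto
    then obtain r where r: "{p, q, r} = {x, y, z}" "distinct [p, q, r]"
      using pq(3) by auto
    then have "K23_in u w p q r" using K by (auto simp: K23_in_def)
    moreover have "{u, w, p, q, r} = ?S" using r(1) by auto
    ultimately show False using middle' er by blast
  qed
  have "c \<in> {u, w} \<or> c \<in> {x, y, z}" "d \<in> {u, w} \<or> d \<in> {x, y, z}" using S by auto
  then show False
    using branch[OF ear] edge[OF ear] edge[OF ear_rev[OF ear]] middle[OF ear] S(3) by blast
qed

lemma K23_no_lollipop:
  assumes K: "K23_in u w x y z" and c: "c \<in> {u, w, x, y, z}" and lp: "lollipop {u, w, x, y, z} c as bs"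
  shows False
proof -
  \<comment> \<open>The list \<open>c # cs\<close> is a 4-cycle through \<open>c\<close>; it serves
    as the first cycle of a dumbbell.\<close>
  define cs where "cs = (if c = u then [x, w, y] else if c = w then [x, u, y]
    else if c = x then [u, y, w] else [u, x, w])"
  show False
  proof (rule no_dumbbell[of c cs as bs])
    have cs: "distinct (c # cs)" "set cs \<subseteq> {u, w, x, y, z}" "length cs = 3" "walk E (c # cs @ [c])"
      using K c by (auto simp: cs_def K23_in_def insert_commute)
    show "walk E (c # cs @ [c])" "length cs \<ge> 2" using cs by auto
    have "{u, w, x, y, z} \<subseteq> V" using K by (simp add: K23_in_def)
    then show "distinct (c # cs @ as @ bs)" "set (c # cs @ as @ bs) \<subseteq> V"
      using cs(1,2) lp c unfolding lollipop_def by auto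
  qed (use lp in \<open>auto simp: lollipop_def\<close>)
qed

lemma K23_spanning:
  assumes K: "K23_in u w x y z"
  shows "V = {u, w, x, y, z}"
proof (rule ccontr)
  assume "V \<noteq> {u, w, x, y, z}"
  moreover have "{u, w, x, y, z} \<subseteq> V" using K by (simp add: K23_in_def)
  ultimately have "(\<exists>c\<in>{u, w, x, y, z}. \<exists>as bs. lollipop {u, w, x, y, z} c as bs) \<or>
      (\<exists>c\<in>{u, w, x, y, z}. \<exists>d\<in>{u, w, x, y, z}. \<exists>zs. c \<noteq> d \<and> ear {u, w, x, y, z} c zs d)"
    by (intro lollipop_or_ear) auto
  then show False
    by (elim disjE bexE exE conjE) (erule (1) K23_no_lollipop[OF K], erule (3) K23_no_ear[OF K])
qed

lemma K23_iso:
  assumes K: "K23_in u w x y z"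
  shows "graph_iso (V, E) K23"
proof -
  note V = K23_spanning[OF K]
  have dist: "distinct [u, w, x, y, z]" using K by (simp add: K23_in_def)
  have "\<exists>f :: 'a \<Rightarrow> nat. f u = 0 \<and> f w = 1 \<and> f x = 2 \<and> f y = 3 \<and> f z = 4"
    using dist by (intro exI[of _ "(\<lambda>_. 0)(w := 1, x := 2, y := 3, z := 4)"]) auto
  then obtain f :: "'a \<Rightarrow> nat" where f: "f u = 0" "f w = 1" "f x = 2" "f y = 3" "f z = 4" by blast
  have adj: "{a, b} \<in> E" "{b, a} \<in> E" if "a \<in> {u, w}" "b \<in> {x, y, z}" for a b
    using K that by (auto simp: K23_in_def insert_commute)
  \<comment> \<open>The colouring \<open>\<beta>\<close> is constant on each side of the copy, which
    rules out edges within a side.\<close>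
  have col: "\<beta> b = 3 - \<beta> u" if "b \<in> {x, y, z}" for b
    using \<beta>_proper[OF adj(1)[of u b]] \<beta>_range[of u] \<beta>_range[of b] that V by auto
  have col': "\<beta> w = \<beta> u"
    using \<beta>_proper[OF adj(1)[of w x]] \<beta>_range[of u] \<beta>_range[of w] col[of x] V by auto
  have nadj: "{a, b} \<notin> E" if "a \<in> {u, w} \<and> b \<in> {u, w} \<or> a \<in> {x, y, z} \<and> b \<in> {x, y, z}" for a b
  proof -
    have "\<beta> v = \<beta> u" if "v \<in> {u, w}" for v using col' that by auto
    then have "\<beta> a = \<beta> b" using that col by metis
    then show ?thesis using \<beta>_proper by blast
  qed
  have img: "f ` V = {0..<5}"
    unfolding V image_insert f by auto
  have "card V = 5" unfolding V using dist by simp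
  then have "inj_on f V" using img simple by (intro eq_card_imp_inj_on) (auto simp: simple_graph_def)
  then have "bij_betw f V {0..<5}" using img by (simp add: bij_betw_def)
  moreover have "{a, b} \<in> E \<longleftrightarrow> {f a, f b} \<in> snd K23" if ab: "a \<in> V" "b \<in> V" for a b
  proof -
    have K23_iff: "{i, j} \<in> snd K23 \<longleftrightarrow> i \<in> {0, 1} \<and> j \<in> {2, 3, 4} \<or> j \<in> {0, 1} \<and> i \<in> {2, 3, 4}" for i j
      by (auto simp: K23_def doubleton_eq_iff)
    have side: "f v \<in> {0, 1} \<longleftrightarrow> v \<in> {u, w}" "f v \<in> {2, 3, 4} \<longleftrightarrow> v \<in> {x, y, z}" if "v \<in> V" for v
      using that dist unfolding V by (auto simp: f)
    have parts: "v \<in> {u, w} \<or> v \<in> {x, y, z}" if "v \<in> V" for v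
      using that unfolding V by blast
    have disj: "\<not> (v \<in> {u, w} \<and> v \<in> {x, y, z})" for v using dist by auto
    show ?thesis
      unfolding K23_iff side[OF ab(1)] side[OF ab(2)]
      using adj(1)[of a b] adj(2)[of b a] nadj[of a b] parts[OF ab(1)] parts[OF ab(2)]
        disj[of a] disj[of b] by argo
  qed
  ultimately show ?thesis unfolding graph_iso_def by (intro exI[of _ f]) (simp add: K23_def)
qed

text \<open>There are no further edges by \<open>cycle_no_chord\<close>, and the length is even
  because \<open>\<beta>\<close> alternates around the cycle.\<close>

lemma Hamilton_cycle_iso:
  assumes cyc: "cycle vs" and V: "set vs = V"
  shows "\<exists>k\<ge>1. graph_iso (V, E) (cycle_graph (2 * k + 2))"
proof -
  let ?n = "length vs"
  have n: "?n \<ge> 3" and dist: "distinct vs" and wk: "walk E (vs @ [hd vs])"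
    using cyc by (auto simp: cycle_def)
  have "odd (length (vs @ [hd vs]))"
    using walk_parity[OF wk] n V by (cases vs) auto
  then have "even ?n" by simp
  then obtain l where l: "?n = 2 * l" by (elim evenE)
  define k where "k = l - 1"
  have k: "?n = 2 * k + 2" "k \<ge> 1" using l n by (auto simp: k_def)
  have step: "{vs ! i, vs ! ((i + 1) mod ?n)} \<in> E" if "i < ?n" for i
  proof -
    have "{(vs @ [hd vs]) ! i, (vs @ [hd vs]) ! Suc i} \<in> E"
      using successively_nth[OF wk, of i] that by simp
    moreover have "hd vs = vs ! 0" using n by (intro hd_conv_nth) auto
    ultimately show ?thesis
      using that by (cases "Suc i = ?n") (auto simp: nth_append)
  qed
  have chord: "j = i + 1 \<or> i = 0 \<and> j = ?n - 1" if "i < j" "j < ?n" "{vs ! i, vs ! j} \<in> E" for i j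
  proof -
    define A B D where "A = take i vs" and "B = take (j - Suc i) (drop (Suc i) vs)" and "D = drop (Suc j) vs"
    have "drop (Suc i) vs = B @ vs ! j # D"
      using id_take_nth_drop[of "j - Suc i" "drop (Suc i) vs"] that by (simp add: B_def D_def)
    then have "vs = A @ vs ! i # B @ vs ! j # D"
      using id_take_nth_drop[of i vs] that by (simp add: A_def)
    then have "B = [] \<or> D @ A = []"
      using cycle_no_chord[of A "vs ! i" B "vs ! j" D] cyc that(3) by metis
    then show ?thesis using that by (auto simp: A_def B_def D_def)
  qed
  have adj: "{vs ! i, vs ! j} \<in> E \<longleftrightarrow> {i, j} \<in> snd (cycle_graph ?n)" if "i < ?n" "j < ?n" for i j
  proof -
    have C: "{i, j} \<in> snd (cycle_graph ?n) \<longleftrightarrow> j = (i + 1) mod ?n \<or> i = (j + 1) mod ?n"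
      using that by (auto simp: cycle_graph_def doubleton_eq_iff)
    show ?thesis
      unfolding C
    proof
      assume e: "{vs ! i, vs ! j} \<in> E"
      then have "i \<noteq> j" using edge_distinct(1)[OF simple e] by auto
      then consider "i < j" | "j < i" by linarith
      then show "j = (i + 1) mod ?n \<or> i = (j + 1) mod ?n"
      proof cases
        case 1
        from chord[OF 1 that(2) e] show ?thesis using that n by auto
      next
        case 2
        have "{vs ! j, vs ! i} \<in> E" using e by (simp add: insert_commute)
        from chord[OF 2 that(1) this] show ?thesis using that n by auto
      qed
    next
      assume "j = (i + 1) mod ?n \<or> i = (j + 1) mod ?n"
      then show "{vs ! i, vs ! j} \<in> E"
        using step[OF that(1)] step[OF that(2)] by (auto simp: insert_commute)
    qed
  qed
  have bij: "bij_betw ((!) vs) {0..<?n} V"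
    using dist atLeast0LessThan V by (rule bij_betw_nth[OF _ _ sym])
  let ?\<phi> = "inv_into {0..<?n} ((!) vs)"
  have \<phi>: "?\<phi> v < ?n" "vs ! ?\<phi> v = v" if "v \<in> V" for v
    using bij_betwE[OF bij_betw_inv_into[OF bij]] bij_betw_inv_into_right[OF bij that] that by auto
  have "graph_iso (V, E) (cycle_graph ?n)"
    unfolding graph_iso_def
  proof (intro exI[of _ ?\<phi>] conjI ballI)
    show "bij_betw ?\<phi> (fst (V, E)) (fst (cycle_graph ?n))"
      using bij_betw_inv_into[OF bij] by (simp add: cycle_graph_def)
    fix u v assume "u \<in> fst (V, E)" "v \<in> fst (V, E)"
    then show "({u, v} \<in> snd (V, E)) = ({?\<phi> u, ?\<phi> v} \<in> snd (cycle_graph ?n))"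
      using adj[OF \<phi>(1) \<phi>(1), of u v] \<phi>(2)[of u] \<phi>(2)[of v] by simp
  qed
  then show ?thesis using k by auto
qed

lemma classification:
  "(\<exists>k\<ge>1. graph_iso (V, E) (cycle_graph (2 * k + 2))) \<or> graph_iso (V, E) K23"
proof -
  obtain vs where cyc: "cycle vs" using ex_cycle by blast
  show ?thesis
  proof (cases "set vs = V")
    case True
    then show ?thesis using Hamilton_cycle_iso[OF cyc] by blast
  next
    case False
    moreover have "set vs \<subseteq> V" "set vs \<noteq> {}" using cyc by (auto simp: cycle_def)
    ultimately obtain u w x y z where "K23_in u w x y z"
      using lollipop_or_ear[of "set vs"] cycle_no_lollipop[OF cyc] cycle_ear_K23[OF cyc] by blast
    then show ?thesis using K23_iso by blast
  qed
qed

end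

section \<open>Cores\<close>

lemma ex_core:
  assumes "simple_graph (fst G) (snd G)"
  shows "\<exists>H. is_core G H"
  using assms
proof (induction "card (fst G)" arbitrary: G rule: less_induct)
  case less
  show ?case
  proof (cases "\<forall>v\<in>fst G. degree (fst G) (snd G) v \<noteq> 1")
    case True
    then show ?thesis by (intro exI[of _ G]) (simp add: is_core_def)
  next
    case False
    then obtain v where v: "v \<in> fst G" "degree (fst G) (snd G) v = 1" by blast
    let ?H = "(fst G - {v}, {e \<in> snd G. v \<notin> e})"
    have del: "delete_leaf G ?H" using v by (auto simp: delete_leaf_def)
    then have "simple_graph (fst ?H) (snd ?H)"
      using simple_graph_delete_leaf[OF less.prems, of ?H] by simp
    moreover have "card (fst ?H) < card (fst G)"
      using v less.prems unfolding simple_graph_def fst_conv by (intro card_Diff1_less) auto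
    ultimately obtain K where "is_core ?H K" using less.hyps by blast
    then show ?thesis
      using del unfolding is_core_def by (meson converse_rtranclp_into_rtranclp)
  qed
qed

lemma connected_delete_leaf:
  assumes G: "simple_graph V E" and conn: "connected_graph V E" and del: "delete_leaf (V, E) H"
  shows "connected_graph (fst H) (snd H)"
proof -
  obtain u v where uv: "u \<in> V" "v \<in> V" "u \<noteq> v" "{u, v} \<in> E" and leaf: "\<And>w. {w, v} \<in> E \<Longrightarrow> w = u"
    and H: "H = (V - {v}, {e \<in> E. v \<notin> e})"
    by (rule delete_leafE[OF G del]) (rule that; assumption)
  let ?R = "\<lambda>x y. {x, y} \<in> {e \<in> E. v \<notin> e}"
  \<comment> \<open>A walk can enter and leave \<open>v\<close> only through \<open>u\<close>, so it
    survives the deletion if it waits at \<open>u\<close> instead of visiting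
    \<open>v\<close>.\<close>
  have reach: "?R\<^sup>*\<^sup>* a (if b = v then u else b)" if "(\<lambda>x y. {x, y} \<in> E)\<^sup>*\<^sup>* a b" "a \<noteq> v" for a b
    using that
  proof (induction rule: rtranclp_induct)
    case base
    then show ?case by simp
  next
    case (step y z)
    consider "y = v" | "z = v" | "y \<noteq> v" "z \<noteq> v" by blast
    then show ?case
    proof cases
      case 1
      then have "z = u" using step(2) leaf[of z] by (simp add: insert_commute)
      then show ?thesis using step 1 uv(3) by simp
    next
      case 2
      then have "y = u" using step(2) leaf by simp
      then show ?thesis using step 2 uv(3) by simp
    next
      case 3
      then have "?R y z" using step(2) by auto
      then show ?thesis using step 3 by (auto intro: rtranclp.rtrancl_into_rtrancl)
    qed
  qed
  have "?R\<^sup>*\<^sup>* a b" if ab: "a \<in> V - {v}" "b \<in> V - {v}" for a b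
  proof -
    have "(\<lambda>x y. {x, y} \<in> E)\<^sup>*\<^sup>* a b" using conn ab unfolding connected_graph_def by blast
    from reach[OF this] show ?thesis using ab by simp
  qed
  then show ?thesis unfolding H connected_graph_def by simp
qed

lemma delete_leaves_properties:
  assumes "delete_leaf\<^sup>*\<^sup>* G H" "simple_graph (fst G) (snd G)" "connected_graph (fst G) (snd G)"
  shows "simple_graph (fst H) (snd H) \<and> connected_graph (fst H) (snd H) \<and> fst H \<subseteq> fst G \<and> snd H \<subseteq> snd G"
  using assms(1)
proof induction
  case base
  then show ?case using assms by simp
next
  case (step y z)
  then have "simple_graph (fst z) (snd z)" "connected_graph (fst z) (snd z)"
    using simple_graph_delete_leaf[of "fst y" "snd y" z] connected_delete_leaf[of "fst y" "snd y" z] by auto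
  moreover have "fst z \<subseteq> fst y" "snd z \<subseteq> snd y" using step(2) by (auto simp: delete_leaf_def)
  ultimately show ?case using step by auto
qed

theorem theorem10:
  fixes V :: "'a set" and E :: "'a set set"
  assumes "simple_graph V E" and "connected_graph V E" and "chromatic_number V E = 2"
  shows "enum_chromatic_choosable V E \<longleftrightarrow>
    (\<exists>H. is_core (V, E) H \<and>
       (graph_iso H K1 \<or> (\<exists>k::nat. k \<ge> 1 \<and> graph_iso H (cycle_graph (2 * k + 2))) \<or> graph_iso H K23))"
proof
  assume "enum_chromatic_choosable V E"
  then have min: "count_minimal (V, E) 2"
    using assms(3) by (simp add: enum_chromatic_choosable_def list_color_fun_eq_iff)
  obtain H where core: "is_core (V, E) H" using ex_core[of "(V, E)"] assms(1) by auto
  obtain V' E' where H: "H = (V', E')" by (cases H)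
  have H': "simple_graph V' E'" "connected_graph V' E'" "V' \<subseteq> V" "E' \<subseteq> E"
    using delete_leaves_properties[of "(V, E)" H] core assms by (auto simp: is_core_def H)
  have "graph_iso H K1 \<or> (\<exists>k::nat. k \<ge> 1 \<and> graph_iso H (cycle_graph (2 * k + 2))) \<or> graph_iso H K23"
  proof (cases "\<exists>v. V' = {v}")
    case True
    then obtain v where v: "V' = {v}" by blast
    have "{a, b} \<notin> E'" for a b using edge_distinct[OF H'(1), of a b] v by auto
    then have "{a, b} \<in> E' \<longleftrightarrow> {0, 0} \<in> snd K1" for a b by (simp add: K1_def)
    moreover have "bij_betw (\<lambda>_. 0) V' (fst K1)" by (simp add: v K1_def bij_betw_def)
    ultimately have "graph_iso H K1" unfolding graph_iso_def H by (intro exI[of _ "\<lambda>_. 0"]) simp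
    then show ?thesis by blast
  next
    case False
    obtain \<beta> where \<beta>: "\<beta> \<in> Pi\<^sub>E V (\<lambda>_. {1..2::nat})" "proper_col E \<beta>"
      by (rule two_coloring[OF assms(1,3)])
    have "flexible_bipartite_graph V' E' \<beta>"
    proof
      show "degree V' E' v \<ge> 2" if v: "v \<in> V'" for v
      proof -
        obtain u where "u \<in> V'" "{v, u} \<in> E'"
          using crossing_edge[OF H'(1,2), of "{v}"] v False by blast
        then have "u \<in> {u \<in> V'. {u, v} \<in> E'}" by (simp add: insert_commute)
        moreover have "finite {u \<in> V'. {u, v} \<in> E'}" using H'(1) by (simp add: simple_graph_def)
        ultimately have "degree V' E' v > 0" unfolding degree_def by (metis card_gt_0_iff empty_iff)
        moreover have "degree V' E' v \<noteq> 1" using core v by (simp add: is_core_def H)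
        ultimately show ?thesis by linarith
      qed
      show "\<beta> v \<in> {1, 2}" if "v \<in> V'" for v
        using PiE_mem[OF \<beta>(1), of v] that H'(3) by auto
      show "\<beta> u \<noteq> \<beta> v" if "{u, v} \<in> E'" for u v
        using \<beta>(2) that H'(4) unfolding proper_col_iff[OF assms(1)] by blast
      show "\<not> rigid E' W" if "W \<subseteq> V'" "W \<noteq> {}" for W
        using not_count_minimal_if_rigid[OF assms, of W] min rigid_mono[of E' W E] that H'(3,4) by blast
    qed (use H' in auto)
    from flexible_bipartite_graph.classification[OF this] show ?thesis unfolding H by blast
  qed
  then show "\<exists>H. is_core (V, E) H \<and>
       (graph_iso H K1 \<or> (\<exists>k::nat. k \<ge> 1 \<and> graph_iso H (cycle_graph (2 * k + 2))) \<or> graph_iso H K23)"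
    using core by blast
next
  assume "\<exists>H. is_core (V, E) H \<and>
       (graph_iso H K1 \<or> (\<exists>k::nat. k \<ge> 1 \<and> graph_iso H (cycle_graph (2 * k + 2))) \<or> graph_iso H K23)"
  then obtain H where core: "is_core (V, E) H"
    and iso: "graph_iso H K1 \<or> (\<exists>k::nat. k \<ge> 1 \<and> graph_iso H (cycle_graph (2 * k + 2))) \<or> graph_iso H K23"
    by blast
  have leaves: "delete_leaf\<^sup>*\<^sup>* (V, E) H" using core by (simp add: is_core_def)
  have H: "simple_graph (fst H) (snd H)"
    using simple_graph_delete_leaves[OF leaves] assms(1) by simp
  have minH: "count_minimal H m" if m: "m \<ge> 2" for m
  proof -
    have transfer: "count_minimal H m"
      if "graph_iso H K" "simple_graph (fst K) (snd K)" "count_minimal K m" for K :: "nat set \<times> nat set set"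
      using count_minimal_iso[OF H that(2), of m] that by simp
    from iso show ?thesis
    proof (elim disjE exE conjE)
      assume "graph_iso H K1"
      then show ?thesis
        by (rule transfer[OF _ _ count_minimal_K1]) (simp add: K1_def simple_graph_def)
    next
      fix k :: nat assume "k \<ge> 1" "graph_iso H (cycle_graph (2 * k + 2))"
      then show ?thesis
        using transfer[OF _ _ count_minimal_even_cycle[OF _ m]] simple_graph_cycle[of "2 * k + 2"]
        by (simp add: cycle_graph_def)
    next
      assume "graph_iso H K23"
      then show ?thesis
        using transfer[OF _ _ count_minimal_K23[OF m]] simple_graph_K23 by (simp add: K23_def)
    qed
  qed
  have "count_minimal (V, E) m" if "m \<ge> 2" for m
    using count_minimal_delete_leaves[OF leaves _ minH[OF that]] assms(1) by simp
  then show "enum_chromatic_choosable V E"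
    using assms(3) by (simp add: enum_chromatic_choosable_def list_color_fun_eq_iff)
qed

end
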